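(* Let $R$ be a Dedekind domain with field of fractions $K$. Let $k,n\in\mathbb{N}$, let $a_1,\dots,a_k,b_1,\dots,b_k,c_1,\dots,c_k\in R\setminus\{0\}$, and let $$I:=\bigcap_{i=1}^k\left\{\frac{a_i}{c_i},\frac{b_i}{c_i},\frac{a_i+b_i}{c_i}\right\}.$$ Suppose that there exists a nonzero prime ideal $\mathfrak{p}\subseteq R$ satisfying: (i) none of $a_1,\dots,a_k,b_1,\dots,b_k,c_1,\dots,c_k,a_1+b_1,\dots,a_k+b_k$ is contained in $\mathfrak{p}$; (ii) if $v_1,v_2\in\bigcup_{i=1}^k\left\{\frac{a_i}{c_i},\frac{b_i}{c_i},\frac{a_i+b_i}{c_i}\right\}$ are distinct, then $v_1\not\equiv v_2\pmod{\mathfrak{p}}$; (iii) no element of $I$ is an $n$th power modulo $\mathfrak{p}$; (iv) $[R:\mathfrak{p}]<\infty$. Then the system of equations $$a_ix_i+b_iy_i=c_iw_iz_i^n,\qquad 1\le i\le k,$$ in the variables $x_i,y_i,w_i,z_i$ ($1\le i\le k$) is not partition regular over $K_{\mathfrak{p}}\setminus\{0\}$, where $K_{\mathfrak{p}}$ is the completion of $K$ at $\mathfrak{p}$.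
   Context: For $u\in R$ and $v\in R\setminus\mathfrak{p}$, the residue of $\frac{u}{v}$ modulo $\mathfrak{p}$ is $uv^{-1}$ in the field $R/\mathfrak{p}$; congruences and $n$th powers modulo $\mathfrak{p}$ are understood in this sense. $[R:\mathfrak{p}]$ is the index of $\mathfrak{p}$ in $(R,+)$. The set $I$ may be empty. A system of equations is partition regular over a set $S$ if for every finite partition of $S$ some single cell contains values of all the variables (not necessarily distinct) satisfying all the equations. *)

theory Defs
  imports "HOL-Algebra.Polynomials" "HOL-Algebra.Ideal_Product" "HOL-Algebra.Ring_Divisibility"
    "HOL-Library.Disjoint_Sets"
begin

text \<open>A domain and its field of fractions are given as a subset \<open>R\<close> of the carrier of a
  field \<open>K\<close>.  The ring \<open>R\<close> itself is \<open>K\<lparr>carrier := R\<rparr>\<close>.\<close>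

abbreviation ring_on :: "('a, 'm) ring_scheme \<Rightarrow> 'a set \<Rightarrow> ('a, 'm) ring_scheme" where
  "ring_on K R \<equiv> K\<lparr>carrier := R\<rparr>"

locale field_of_fractions = field K + subring R K for K (structure) and R +
  assumes fractions:
    "x \<in> carrier K \<Longrightarrow> \<exists>u\<in>R. \<exists>v\<in>R - {\<zero>}. x = u \<otimes> inv v"

definition integral_over :: "('a, 'm) ring_scheme \<Rightarrow> 'a set \<Rightarrow> 'a \<Rightarrow> bool" where
  "integral_over K R x \<longleftrightarrow>
     (\<exists>f \<in> carrier (univ_poly K R).
        f \<noteq> [] \<and> lead_coeff f = \<one>\<^bsub>K\<^esub> \<and> ring.eval K f x = \<zero>\<^bsub>K\<^esub>)"

locale dedekind_domain = field_of_fractions +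
  assumes noetherian: "noetherian_domain (ring_on K R)"
    and integrally_closed: "\<lbrakk> x \<in> carrier K; integral_over K R x \<rbrakk> \<Longrightarrow> x \<in> R"
    and prime_imp_maximal:
      "\<lbrakk> primeideal P (ring_on K R); P \<noteq> {\<zero>} \<rbrakk> \<Longrightarrow> maximalideal P (ring_on K R)"

definition residue_field :: "('a, 'm) ring_scheme \<Rightarrow> 'a set \<Rightarrow> 'a set \<Rightarrow> 'a set ring" where
  "residue_field K R p = ring_on K R Quot p"

text \<open>The residue is meaningful for those elements of \<open>K\<close> that have a representation
  \<open>u / v\<close> with \<open>v\<close> outside \<open>p\<close>; it does not depend on the representation chosen.\<close>

definition residue_mod :: "('a, 'm) ring_scheme \<Rightarrow> 'a set \<Rightarrow> 'a set \<Rightarrow> 'a \<Rightarrow> 'a set" where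
  "residue_mod K R p x =
     (THE r. \<exists>u\<in>R. \<exists>v\<in>R - p. x = u \<otimes>\<^bsub>K\<^esub> inv\<^bsub>K\<^esub> v \<and>
        r = (p +>\<^bsub>ring_on K R\<^esub> u) \<otimes>\<^bsub>residue_field K R p\<^esub>
              inv\<^bsub>residue_field K R p\<^esub> (p +>\<^bsub>ring_on K R\<^esub> v))"

definition cong_mod :: "('a, 'm) ring_scheme \<Rightarrow> 'a set \<Rightarrow> 'a set \<Rightarrow> 'a \<Rightarrow> 'a \<Rightarrow> bool" where
  "cong_mod K R p x y \<longleftrightarrow> residue_mod K R p x = residue_mod K R p y"

definition nth_power_mod :: "('a, 'm) ring_scheme \<Rightarrow> 'a set \<Rightarrow> 'a set \<Rightarrow> nat \<Rightarrow> 'a \<Rightarrow> bool" where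
  "nth_power_mod K R p n x \<longleftrightarrow>
     (\<exists>r \<in> carrier (residue_field K R p).
        residue_mod K R p x = r [^]\<^bsub>residue_field K R p\<^esub> n)"

definition padic_ord :: "('a, 'm) ring_scheme \<Rightarrow> 'a set \<Rightarrow> 'a set \<Rightarrow> 'a \<Rightarrow> nat" where
  "padic_ord K R p u = (GREATEST m. u \<in> p [^]\<^bsub>ideals_set (ring_on K R)\<^esub> m)"

text \<open>The valuation at \<open>p\<close> of a nonzero element of \<open>K\<close>.  Its value at zero is unspecified,
  zero being treated separately below.\<close>

definition padic_val :: "('a, 'm) ring_scheme \<Rightarrow> 'a set \<Rightarrow> 'a set \<Rightarrow> 'a \<Rightarrow> int" where
  "padic_val K R p x =
     (THE m. \<exists>u\<in>R - {\<zero>\<^bsub>K\<^esub>}. \<exists>v\<in>R - {\<zero>\<^bsub>K\<^esub>}. x = u \<otimes>\<^bsub>K\<^esub> inv\<^bsub>K\<^esub> v \<and>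
        m = int (padic_ord K R p u) - int (padic_ord K R p v))"

definition padic_close ::
  "('a, 'm) ring_scheme \<Rightarrow> 'a set \<Rightarrow> 'a set \<Rightarrow> int \<Rightarrow> 'a \<Rightarrow> 'a \<Rightarrow> bool" where
  "padic_close K R p N x y \<longleftrightarrow> x = y \<or> N \<le> padic_val K R p (x \<ominus>\<^bsub>K\<^esub> y)"

definition padic_cauchy ::
  "('a, 'm) ring_scheme \<Rightarrow> 'a set \<Rightarrow> 'a set \<Rightarrow> (nat \<Rightarrow> 'a) \<Rightarrow> bool" where
  "padic_cauchy K R p s \<longleftrightarrow>
     (\<forall>i. s i \<in> carrier K) \<and>
     (\<forall>N. \<exists>M. \<forall>i\<ge>M. \<forall>j\<ge>M. padic_close K R p N (s i) (s j))"

definition padic_null ::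
  "('a, 'm) ring_scheme \<Rightarrow> 'a set \<Rightarrow> 'a set \<Rightarrow> (nat \<Rightarrow> 'a) \<Rightarrow> bool" where
  "padic_null K R p s \<longleftrightarrow>
     (\<forall>i. s i \<in> carrier K) \<and>
     (\<forall>N. \<exists>M. \<forall>i\<ge>M. padic_close K R p N (s i) \<zero>\<^bsub>K\<^esub>)"

definition cauchy_ring ::
  "('a, 'm) ring_scheme \<Rightarrow> 'a set \<Rightarrow> 'a set \<Rightarrow> (nat \<Rightarrow> 'a) ring" where
  "cauchy_ring K R p =
     \<lparr> carrier = {s. padic_cauchy K R p s},
       mult = (\<lambda>s t i. s i \<otimes>\<^bsub>K\<^esub> t i),
       one = (\<lambda>i. \<one>\<^bsub>K\<^esub>),
       zero = (\<lambda>i. \<zero>\<^bsub>K\<^esub>),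
       add = (\<lambda>s t i. s i \<oplus>\<^bsub>K\<^esub> t i) \<rparr>"

definition completion ::
  "('a, 'm) ring_scheme \<Rightarrow> 'a set \<Rightarrow> 'a set \<Rightarrow> (nat \<Rightarrow> 'a) set ring" where
  "completion K R p = cauchy_ring K R p Quot {s. padic_null K R p s}"

definition completion_embed ::
  "('a, 'm) ring_scheme \<Rightarrow> 'a set \<Rightarrow> 'a set \<Rightarrow> 'a \<Rightarrow> (nat \<Rightarrow> 'a) set" where
  "completion_embed K R p x = {s. padic_null K R p s} +>\<^bsub>cauchy_ring K R p\<^esub> (\<lambda>i. x)"

text \<open>A system in the variables \<open>V\<close> is represented by the predicate \<open>Sol\<close> that holds of an
  assignment iff it satisfies all the equations.\<close>

definition partition_regular :: "'s set \<Rightarrow> 'v set \<Rightarrow> (('v \<Rightarrow> 's) \<Rightarrow> bool) \<Rightarrow> bool" where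
  "partition_regular S V Sol \<longleftrightarrow>
     (\<forall>\<C>. finite \<C> \<and> partition_on S \<C> \<longrightarrow>
        (\<exists>A\<in>\<C>. \<exists>\<phi>. (\<forall>v\<in>V. \<phi> v \<in> A) \<and> Sol \<phi>))"

datatype system_var = VarX nat | VarY nat | VarW nat | VarZ nat

definition system_vars :: "nat \<Rightarrow> system_var set" where
  "system_vars k = (\<Union>i\<in>{1..k}. {VarX i, VarY i, VarW i, VarZ i})"

definition coeff_ratios :: "('a, 'm) ring_scheme \<Rightarrow> 'a \<Rightarrow> 'a \<Rightarrow> 'a \<Rightarrow> 'a set" where
  "coeff_ratios K a b c =
     {a \<otimes>\<^bsub>K\<^esub> inv\<^bsub>K\<^esub> c, b \<otimes>\<^bsub>K\<^esub> inv\<^bsub>K\<^esub> c, (a \<oplus>\<^bsub>K\<^esub> b) \<otimes>\<^bsub>K\<^esub> inv\<^bsub>K\<^esub> c}"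

end

theory Submission
  imports Defs
begin

text \<open>
  A nonzero element \<open>x\<close> of the completion is coloured by its angular component, the residue of
  \<open>x / \<varpi>^v(x)\<close>, where \<open>v\<close> is the valuation and \<open>\<varpi>\<close> a uniformizer.  The residue field is finite, so
  there are finitely many colours.  Angular components are multiplicative, and those of a sum are governed by the
  summands of least valuation.  Suppose that \<open>x, y, w, z\<close> have the same colour \<open>r\<close> and satisfy
  \<open>a x + b y = c w z^n\<close>.  Comparing leading coefficients gives \<open>u r = c r r^n\<close>, where \<open>u\<close> is \<open>a\<close>,
  \<open>b\<close> or \<open>a + b\<close>, according to whether \<open>v(x)\<close> is less than, greater than or equal to \<open>v(y)\<close>; no
  cancellation can occur because none of the three is in \<open>p\<close>.  Hence one of the three ratios of each
  equation is congruent to \<open>r^n\<close> (\<open>equation_residue\<close>).  In a monochromatic solution \<open>r\<close> is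
  the same for all equations, and as distinct ratios are incongruent, the ratios
  found for the various equations coincide.  Their common value lies in \<open>I\<close> and is an \<open>n\<close>th power modulo
  \<open>p\<close>, which is excluded.

  Two things have to be supplied.  The first is the structure of \<open>K\<close> at \<open>p\<close>: every nonzero
  element is a power of a uniformizer times a unit of the localization, and the exponent is the valuation
  defined by powers of the ideal \<open>p\<close>.  The inverse of the uniformizer is found as an element whose
  ideal of denominators is exactly \<open>p\<close> (\<open>p_is_denominators\<close>).  Integral closedness is used through
  \<open>almost_integral_imp_in_R\<close>: an element all of whose powers have a common denominator lies in \<open>R\<close>.
  This shows both that the element found is the inverse of a uniformizer and that division by the
  uniformizer ends after finitely many steps.

  The second is the passage to the completion.  Along a Cauchy sequence that is not null, the valuation and the
  angular component are eventually constant (\<open>padic_cauchy_not_null\<close>).  So an equation in the completion is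
  examined at a single late index, as an equation in \<open>K\<close> with an error of large valuation.
\<close>

section \<open>Fractions in a field\<close>

context field
begin

lemma nonzero_inv:
  assumes "x \<in> carrier R - {\<zero>}"
  shows "inv x \<in> carrier R" "inv x \<noteq> \<zero>" "x \<otimes> inv x = \<one>" "inv x \<otimes> x = \<one>" "inv (inv x) = x"
proof -
  have u: "x \<in> Units R" using assms field_Units by simp
  then have "inv x \<in> Units R" by simp
  then show "inv x \<in> carrier R" "inv x \<noteq> \<zero>" using field_Units by auto
  show "x \<otimes> inv x = \<one>" "inv x \<otimes> x = \<one>" "inv (inv x) = x" using u by simp_all
qed

lemma inv_of_mult:
  assumes "x \<in> carrier R - {\<zero>}" "y \<in> carrier R - {\<zero>}"
  shows "inv (x \<otimes> y) = inv x \<otimes> inv y"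
proof -
  have "(x \<otimes> y) \<otimes> (inv x \<otimes> inv y) = (x \<otimes> inv x) \<otimes> (y \<otimes> inv y)"
    using assms nonzero_inv(1)[of x] nonzero_inv(1)[of y] by (simp add: m_ac)
  then have "(x \<otimes> y) \<otimes> (inv x \<otimes> inv y) = \<one>"
    using assms nonzero_inv(3)[of x] nonzero_inv(3)[of y] by simp
  then show ?thesis
    using assms nonzero_inv(1)[of x] nonzero_inv(1)[of y]
    by (metis DiffD1 comm_inv_char m_closed)
qed

lemma eq_fraction_iff:
  assumes "x \<in> carrier R" "u \<in> carrier R" "v \<in> carrier R - {\<zero>}"
  shows "x = u \<otimes> inv v \<longleftrightarrow> x \<otimes> v = u"
proof -
  note i = nonzero_inv[OF assms(3)]
  have "(u \<otimes> inv v) \<otimes> v = u" "(x \<otimes> v) \<otimes> inv v = x"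
    using assms i by (simp_all add: m_assoc)
  then show ?thesis by metis
qed

lemma fraction_eq_iff:
  assumes "u \<in> carrier R" "v \<in> carrier R - {\<zero>}" "s \<in> carrier R" "t \<in> carrier R - {\<zero>}"
  shows "u \<otimes> inv v = s \<otimes> inv t \<longleftrightarrow> u \<otimes> t = s \<otimes> v"
proof -
  note i = nonzero_inv[OF assms(2)] nonzero_inv[OF assms(4)]
  have c: "v \<in> carrier R" "v \<noteq> \<zero>" "t \<in> carrier R" "t \<noteq> \<zero>" using assms by auto
  have "u \<otimes> inv v = s \<otimes> inv t \<longleftrightarrow> (u \<otimes> inv v) \<otimes> t = s"
    using assms i by (intro eq_fraction_iff) auto
  also have "(u \<otimes> inv v) \<otimes> t = (u \<otimes> t) \<otimes> inv v" using assms i by (simp add: m_ac)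
  also have "(u \<otimes> t) \<otimes> inv v = s \<longleftrightarrow> s = (u \<otimes> t) \<otimes> inv v" by auto
  also have "\<dots> \<longleftrightarrow> s \<otimes> v = u \<otimes> t"
    using assms by (intro eq_fraction_iff) auto
  finally show ?thesis by auto
qed

lemma fraction_mult:
  assumes "u \<in> carrier R" "v \<in> carrier R - {\<zero>}" "s \<in> carrier R" "t \<in> carrier R - {\<zero>}"
  shows "(u \<otimes> inv v) \<otimes> (s \<otimes> inv t) = (u \<otimes> s) \<otimes> inv (v \<otimes> t)"
  using assms nonzero_inv(1)[OF assms(2)] nonzero_inv(1)[OF assms(4)]
  by (simp add: inv_of_mult m_ac)

lemma fraction_add:
  assumes "u \<in> carrier R" "v \<in> carrier R - {\<zero>}" "s \<in> carrier R" "t \<in> carrier R - {\<zero>}"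
  shows "(u \<otimes> inv v) \<oplus> (s \<otimes> inv t) = (u \<otimes> t \<oplus> s \<otimes> v) \<otimes> inv (v \<otimes> t)"
proof -
  note i = nonzero_inv[OF assms(2)] nonzero_inv[OF assms(4)]
  have c: "v \<in> carrier R" "v \<noteq> \<zero>" "t \<in> carrier R" "t \<noteq> \<zero>" using assms by auto
  have 1: "(u \<otimes> inv v) \<otimes> (v \<otimes> t) = u \<otimes> t"
  proof -
    have "(u \<otimes> inv v) \<otimes> (v \<otimes> t) = u \<otimes> (inv v \<otimes> v) \<otimes> t"
      using assms(1) c i(1,6) by (simp only: m_assoc m_closed)
    then show ?thesis using assms(1) c i(4) by simp
  qed
  have 2: "(s \<otimes> inv t) \<otimes> (v \<otimes> t) = s \<otimes> v"
  proof -
    have "(s \<otimes> inv t) \<otimes> (v \<otimes> t) = s \<otimes> v \<otimes> (inv t \<otimes> t)" using assms(3) c i(1,6) by (simp add: m_ac)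
    then show ?thesis using assms(3) c i(9) by simp
  qed
  have "((u \<otimes> inv v) \<oplus> (s \<otimes> inv t)) \<otimes> (v \<otimes> t) = u \<otimes> t \<oplus> s \<otimes> v"
    using assms c i by (simp add: l_distr 1 2)
  moreover have "v \<otimes> t \<noteq> \<zero>" using c integral by blast
  ultimately show ?thesis using assms c i by (subst eq_fraction_iff) auto
qed

lemma nonzero_m_closed: "\<lbrakk>x \<in> carrier R - {\<zero>}; y \<in> carrier R - {\<zero>}\<rbrakk> \<Longrightarrow> x \<otimes> y \<in> carrier R - {\<zero>}"
  using integral by blast

lemma nonzero_pow_closed: "x \<in> carrier R - {\<zero>} \<Longrightarrow> x [^] (n::nat) \<in> carrier R - {\<zero>}"
  by (induction n) (use nonzero_m_closed in auto)

text \<open>Integer powers obey the laws of exponents in groups only, so they are transferred from the group of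
  units; nonzero elements of a field are exactly its units.\<close>

lemma int_pow_units_of:
  assumes x: "x \<in> carrier R - {\<zero>}"
  shows "x [^]\<^bsub>units_of R\<^esub> (z::int) = x [^] z"
proof -
  have n: "x [^]\<^bsub>units_of R\<^esub> (n::nat) = x [^] n" for n
    by (induction n) (simp_all add: units_of_one units_of_mult)
  have "x [^] nat (- z) \<in> Units R" using nonzero_pow_closed[OF x] field_Units by simp
  then have "inv\<^bsub>units_of R\<^esub> (x [^] nat (- z)) = inv (x [^] nat (- z))" by (rule units_of_inv)
  then show ?thesis unfolding int_pow_def2 n by (simp only:)
qed

lemma int_pow_nonzero: "x \<in> carrier R - {\<zero>} \<Longrightarrow> x [^] (z::int) \<in> carrier R - {\<zero>}"
  using group.int_pow_closed[OF units_group, of x z] int_pow_units_of[of x z] field_Units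
    by (simp add: units_of_carrier)

lemma int_pow_add:
  assumes x: "x \<in> carrier R - {\<zero>}"
  shows "x [^] (y + z :: int) = x [^] y \<otimes> x [^] z"
  using group.int_pow_mult[OF units_group, of x y z] x field_Units
  by (simp add: int_pow_units_of units_of_carrier units_of_mult)

lemma int_pow_minus_mult:
  assumes x: "x \<in> carrier R - {\<zero>}"
  shows "x [^] (- z :: int) \<otimes> x [^] z = \<one>"
  using int_pow_add[OF x, of "- z" z] by simp

lemma int_pow_uminus:
  assumes x: "x \<in> carrier R - {\<zero>}"
  shows "x [^] (- z :: int) = inv (x [^] z)"
proof -
  have "x [^] z \<otimes> x [^] (- z) = \<one>" using int_pow_add[OF x, of z "- z"] by simp
  then show ?thesis using int_pow_nonzero[OF x, of z] int_pow_nonzero[OF x, of "- z"] comm_inv_char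
    by fastforce
qed

end

section \<open>Almost integral elements\<close>

context field_of_fractions
begin

lemma R_carrier: "x \<in> R \<Longrightarrow> x \<in> carrier K"
  using subringE(1)[OF subring_axioms] by blast

lemma R_closed:
  "\<zero> \<in> R" "\<one> \<in> R" "x \<in> R \<Longrightarrow> \<ominus> x \<in> R" "\<lbrakk>x \<in> R; y \<in> R\<rbrakk> \<Longrightarrow> x \<oplus> y \<in> R"
  "\<lbrakk>x \<in> R; y \<in> R\<rbrakk> \<Longrightarrow> x \<otimes> y \<in> R"
  by (fact subringE(2,3,5,6,7)[OF subring_axioms])+

lemma R_pow: "x \<in> R \<Longrightarrow> x [^] (n::nat) \<in> R"
  by (induction n) (simp_all add: R_closed)

lemma cring_R: "cring (ring_on K R)"
  using subring_is_domain[OF subring_axioms] by (simp add: domain_def)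

text \<open>Closure under negatives comes for free, as \<open>- x\<close> is the multiple of \<open>x\<close> by \<open>- 1\<close>.  This keeps the
  additive inverse of \<^term>\<open>ring_on K R\<close>, a different term from that of \<open>K\<close>, out of later proofs.\<close>

lemma ideal_ring_onI:
  assumes "I \<subseteq> R" "\<zero> \<in> I" "\<And>x y. \<lbrakk>x \<in> I; y \<in> I\<rbrakk> \<Longrightarrow> x \<oplus> y \<in> I"
    "\<And>x r. \<lbrakk>x \<in> I; r \<in> R\<rbrakk> \<Longrightarrow> r \<otimes> x \<in> I"
  shows "ideal I (ring_on K R)"
proof -
  interpret A: cring "ring_on K R" by (rule cring_R)
  have neg: "\<ominus>\<^bsub>ring_on K R\<^esub> x \<in> I" if "x \<in> I" for x
  proof -
    have "\<ominus>\<^bsub>ring_on K R\<^esub> x = (\<ominus>\<^bsub>ring_on K R\<^esub> \<one>\<^bsub>ring_on K R\<^esub>) \<otimes>\<^bsub>ring_on K R\<^esub> x"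
      using that assms(1) A.l_minus[of "\<one>" x] R_closed(2) by (auto simp: R_carrier)
    then show ?thesis using assms(4)[OF that, of "\<ominus>\<^bsub>ring_on K R\<^esub> \<one>\<^bsub>ring_on K R\<^esub>"]
      A.a_inv_closed[OF A.one_closed] by simp
  qed
  show ?thesis
  proof (rule idealI)
    show "subgroup I (add_monoid (ring_on K R))"
    proof (rule subgroup.intro)
      show "inv\<^bsub>add_monoid (ring_on K R)\<^esub> x \<in> I" if "x \<in> I" for x
        using neg[OF that] by (simp add: a_inv_def)
    qed (use assms(1-3) in auto)
    show "ring (ring_on K R)" by (rule A.ring_axioms)
    show "x \<otimes>\<^bsub>ring_on K R\<^esub> a \<in> I" if "a \<in> I" "x \<in> carrier (ring_on K R)" for a x
      using assms(4) that by simp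
    show "a \<otimes>\<^bsub>ring_on K R\<^esub> x \<in> I" if "a \<in> I" "x \<in> carrier (ring_on K R)" for a x
    proof -
      have "a \<otimes> x = x \<otimes> a" using that assms(1) by (intro m_comm) (auto simp: R_carrier)
      then show ?thesis using assms(4) that by simp
    qed
  qed
qed

end

context dedekind_domain
begin

text \<open>The \<open>R\<close>-module generated by \<open>1, q, \<dots>, q^(n - 1)\<close>.  It is described by lists of coefficients of fixed
  length, with leading zeros allowed, so that a relation found in it is already a polynomial.\<close>

definition poly_values :: "'a \<Rightarrow> nat \<Rightarrow> 'a set" where
  "poly_values q n = {eval f q | f. set f \<subseteq> R \<and> length f = n}"

lemma poly_valuesI: "\<lbrakk>set f \<subseteq> R; length f = n; eval f q = y\<rbrakk> \<Longrightarrow> y \<in> poly_values q n"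
  unfolding poly_values_def by blast

lemma poly_valuesE:
  assumes "y \<in> poly_values q n"
  obtains f where "set f \<subseteq> R" "length f = n" "y = eval f q"
  using assms unfolding poly_values_def by blast

lemma set_carrier: "set f \<subseteq> R \<Longrightarrow> set f \<subseteq> carrier K"
  using R_carrier by blast

lemma poly_values_add:
  assumes q: "q \<in> carrier K" and "y \<in> poly_values q n" "z \<in> poly_values q n"
  shows "y \<oplus> z \<in> poly_values q n"
proof -
  obtain f where f: "set f \<subseteq> R" "length f = n" "y = eval f q"
    using assms(2) by (rule poly_valuesE)
  obtain g where g: "set g \<subseteq> R" "length g = n" "z = eval g q"
    using assms(3) by (rule poly_valuesE)
  note fg = f g
  have "length f = length g" using fg by simp
  then have "set (map2 (\<oplus>) f g) \<subseteq> R \<and> eval (map2 (\<oplus>) f g) q = y \<oplus> z"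
    using fg(1,4) unfolding fg(3,6)
  proof (induction rule: list_induct2)
    case (Cons x xs y ys)
    have c: "eval xs q \<in> carrier K" "eval ys q \<in> carrier K" "x \<in> carrier K" "y \<in> carrier K"
      using Cons.prems R_carrier q eval_in_carrier[OF set_carrier] by auto
    have "set (map2 (\<oplus>) xs ys) \<subseteq> R" "eval (map2 (\<oplus>) xs ys) q = eval xs q \<oplus> eval ys q"
      using Cons by auto
    then show ?case using Cons.prems Cons.hyps c q R_closed(4) by (simp add: l_distr a_ac)
  qed simp
  then show ?thesis using fg by (intro poly_valuesI[of "map2 (\<oplus>) f g"]) auto
qed

lemma poly_values_smult:
  assumes q: "q \<in> carrier K" and "y \<in> poly_values q n" and r: "r \<in> R"
  shows "r \<otimes> y \<in> poly_values q n"
proof -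
  obtain f where fg: "set f \<subseteq> R" "length f = n" "y = eval f q"
    using assms(2) by (rule poly_valuesE)
  have "eval (map ((\<otimes>) r) f) q = r \<otimes> eval f q" using fg(1)
  proof (induction f)
    case (Cons x xs)
    have "set xs \<subseteq> carrier K" "x \<in> carrier K" using Cons.prems R_carrier by auto
    then show ?case using Cons q r R_carrier[OF r] eval_in_carrier by (simp add: r_distr m_ac)
  qed (use r R_carrier in simp)
  moreover have "set (map ((\<otimes>) r) f) \<subseteq> R" using fg r R_closed(5) by auto
  ultimately show ?thesis using fg by (intro poly_valuesI[of "map ((\<otimes>) r) f"]) auto
qed

lemma poly_values_mono:
  assumes "q \<in> carrier K" shows "poly_values q n \<subseteq> poly_values q (Suc n)"
proof
  fix y assume "y \<in> poly_values q n"
  then obtain f where f: "set f \<subseteq> R" "length f = n" "y = eval f q" by (rule poly_valuesE)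
  then have "eval (\<zero> # f) q = y" using assms eval_in_carrier[OF set_carrier] by simp
  then show "y \<in> poly_values q (Suc n)" using f R_closed(1) by (intro poly_valuesI[of "\<zero> # f"]) auto
qed

lemma zero_poly_values: "q \<in> carrier K \<Longrightarrow> \<zero> \<in> poly_values q n"
proof (induction n)
  case 0 then show ?case by (intro poly_valuesI[of "[]"]) auto
next
  case (Suc n) then show ?case using poly_values_mono by blast
qed

lemma pow_poly_values:
  assumes q: "q \<in> carrier K" shows "q [^] n \<in> poly_values q (Suc n)"
proof -
  obtain f where f: "set f \<subseteq> R" "length f = n" "\<zero> = eval f q"
    using zero_poly_values[OF q, of n] by (rule poly_valuesE)
  have "eval (\<one> # f) q = q [^] n" using f(2) q by (simp add: f(3)[symmetric])
  then show ?thesis using f R_closed(2) by (intro poly_valuesI[of "\<one> # f"]) auto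
qed

text \<open>In a Noetherian integrally closed domain, bounded denominators of all powers of \<open>q\<close> force \<open>q\<close> into the
  domain.  Multiplying the modules generated by \<open>1, q, \<dots>, q^(n - 1)\<close> by the common denominator \<open>d\<close> gives an
  ascending chain of ideals of \<open>R\<close>.  Where it becomes stationary, \<open>q^n\<close> is an \<open>R\<close>-linear combination of
  lower powers, which is an integral equation for \<open>q\<close>.\<close>

lemma almost_integral_imp_in_R:
  assumes q: "q \<in> carrier K" and d: "d \<in> carrier K - {\<zero>}"
    and pow: "\<And>m::nat. q [^] m \<otimes> d \<in> R"
  shows "q \<in> R"
proof -
  interpret A: noetherian_domain "ring_on K R" by (rule noetherian)
  define J where "J n = (\<lambda>y. y \<otimes> d) ` poly_values q n" for n
  have pv: "y \<in> carrier K" if "y \<in> poly_values q n" for y n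
    using that eval_in_carrier[OF set_carrier _] q by (auto elim!: poly_valuesE)
  have ideal: "ideal (J n) (ring_on K R)" for n
  proof (rule ideal_ring_onI)
    show "J n \<subseteq> R"
    proof -
      have "eval f q \<otimes> d \<in> R" if "set f \<subseteq> R" for f using that
      proof (induction f)
        case Nil then show ?case using d R_closed(1) by simp
      next
        case (Cons r f)
        have c: "r \<in> carrier K" "eval f q \<in> carrier K"
          using Cons.prems q R_carrier eval_in_carrier[OF set_carrier] by auto
        have "eval (r # f) q \<otimes> d = r \<otimes> (q [^] length f \<otimes> d) \<oplus> eval f q \<otimes> d"
          using c q d by (simp add: l_distr m_assoc)
        then show ?case using Cons pow R_closed by auto
      qed
      then show ?thesis unfolding J_def by (auto elim!: poly_valuesE)
    qed
    show "\<zero> \<in> J n" using zero_poly_values[OF q, of n] d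
      unfolding J_def by (auto intro!: image_eqI[of _ _ \<zero>])
    fix x assume "x \<in> J n"
    then obtain x' where x': "x = x' \<otimes> d" "x' \<in> poly_values q n" by (auto simp: J_def)
    show "x \<oplus> y \<in> J n" if y: "y \<in> J n" for y
    proof -
      obtain y' where y': "y = y' \<otimes> d" "y' \<in> poly_values q n" using y by (auto simp: J_def)
      have "x \<oplus> y = (x' \<oplus> y') \<otimes> d" using x' y' pv d by (auto simp: l_distr)
      then show ?thesis using poly_values_add[OF q x'(2) y'(2)] by (auto simp: J_def)
    qed
    show "r \<otimes> x \<in> J n" if "r \<in> R" for r
    proof -
      have "r \<otimes> x = (r \<otimes> x') \<otimes> d" using x' pv d that R_carrier by (auto simp: m_assoc)
      then show ?thesis using poly_values_smult[OF q x'(2) that] by (auto simp: J_def)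
    qed
  qed
  have mono: "J m \<subseteq> J n" if "m \<le> n" for m n
    using lift_Suc_mono_le[of J m n] poly_values_mono[OF q] that unfolding J_def by blast
  have "subset.chain {I. ideal I (ring_on K R)} (range J)"
    using ideal mono nat_le_linear unfolding pred_on.chain_def by blast
  then have "\<Union> (range J) \<in> range J" by (intro A.ideal_chain_is_trivial) auto
  then obtain n where "\<Union> (range J) = J n" by auto
  then have "J (Suc n) \<subseteq> J n" by blast
  moreover have "q [^] n \<otimes> d \<in> J (Suc n)" using pow_poly_values[OF q] by (auto simp: J_def)
  ultimately obtain y where "y \<in> poly_values q n" "q [^] n \<otimes> d = y \<otimes> d"
    unfolding J_def by blast
  then obtain f where f: "set f \<subseteq> R" "length f = n" "q [^] n \<otimes> d = eval f q \<otimes> d"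
    by (metis poly_valuesE)
  have ef: "eval f q \<in> carrier K" using f(1) q eval_in_carrier set_carrier by blast
  have eq: "q [^] n = eval f q" using f(3) d ef q m_rcancel[of d "q [^] n" "eval f q"] by auto
  \<comment> \<open>The integral equation is \<open>q^n - eval f q = 0\<close>; negation is applied coefficientwise.\<close>
  have neg: "eval (map (a_inv K) g) q = \<ominus> eval g q" if "set g \<subseteq> R" for g using that
  proof (induction g)
    case (Cons r g)
    have c: "r \<in> carrier K" "eval g q \<in> carrier K"
      using Cons.prems q R_carrier eval_in_carrier[OF set_carrier] by auto
    then show ?case using Cons q by (simp add: l_minus minus_add)
  qed simp
  have "integral_over K R q" unfolding integral_over_def
  proof (intro bexI conjI)
    show "eval (\<one> # map (a_inv K) f) q = \<zero>" using f q ef neg[OF f(1)] eq by (simp add: r_neg)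
    show "\<one> # map (a_inv K) f \<in> carrier (R [X]\<^bsub>K\<^esub>)"
      using f(1) R_closed unfolding univ_poly_carrier[symmetric] polynomial_def by auto
  qed auto
  then show ?thesis using integrally_closed q by blast
qed

end

section \<open>A uniformizer at a nonzero prime\<close>

locale dedekind_prime = dedekind_domain K R for K (structure) and R +
  fixes p :: "'a set"
  assumes prime: "primeideal p (ring_on K R)" and nonzero: "p \<noteq> {\<zero>}"
begin

lemma p_ideal: "ideal p (ring_on K R)"
  using prime by (rule primeideal.axioms(1))

lemma p_in_R: "x \<in> p \<Longrightarrow> x \<in> R"
  using ideal.Icarr[OF p_ideal] by simp

lemma p_closed:
  "\<zero> \<in> p" "\<lbrakk>x \<in> p; y \<in> p\<rbrakk> \<Longrightarrow> x \<oplus> y \<in> p" "\<lbrakk>x \<in> p; r \<in> R\<rbrakk> \<Longrightarrow> r \<otimes> x \<in> p" "\<lbrakk>x \<in> p; r \<in> R\<rbrakk> \<Longrightarrow> x \<otimes> r \<in> p"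
  using additive_subgroup.zero_closed[OF ideal.axioms(1)[OF p_ideal]]
    additive_subgroup.a_closed[OF ideal.axioms(1)[OF p_ideal]]
    ideal.I_l_closed[OF p_ideal] ideal.I_r_closed[OF p_ideal] by simp_all

lemma one_notin_p: "\<one> \<notin> p"
  using ideal.one_imp_carrier[OF p_ideal] primeideal.I_notcarr[OF prime] by auto

lemma units_notin_p_closed:
  "\<one> \<in> R - p" "\<lbrakk>s \<in> R - p; t \<in> R - p\<rbrakk> \<Longrightarrow> s \<otimes> t \<in> R - p" "s \<in> R - p \<Longrightarrow> s [^] (n::nat) \<in> R - p"
proof -
  show 1: "\<one> \<in> R - p" using one_notin_p R_closed by simp
  show 2: "s \<otimes> t \<in> R - p" if "s \<in> R - p" "t \<in> R - p" for s t
    using primeideal.I_prime[OF prime, of s t] that R_closed(5) by auto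
  show "s \<in> R - p \<Longrightarrow> s [^] (n::nat) \<in> R - p"
    by (induction n) (use 1 2 in auto)
qed

lemma notin_p_nonzero: "s \<in> R - p \<Longrightarrow> s \<in> carrier K - {\<zero>}"
  using p_closed(1) R_carrier by auto

text \<open>The prime \<open>p\<close> is maximal, so \<open>p\<close> and \<open>t\<close> together generate the unit ideal.\<close>

lemma inverse_mod_p:
  assumes t: "t \<in> R - p"
  obtains t' e where "t' \<in> R" "e \<in> p" "\<one> = t' \<otimes> t \<oplus> e"
proof -
  interpret M: maximalideal p "ring_on K R" using prime_imp_maximal[OF prime nonzero] .
  define I where "I = {r \<otimes> t \<oplus> e | r e. r \<in> R \<and> e \<in> p}"
  have II: "r \<otimes> t \<oplus> e \<in> I" if "r \<in> R" "e \<in> p" for r e using that unfolding I_def by blast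
  have tR: "t \<in> R" "t \<in> carrier K" using t R_carrier by auto
  have "ideal I (ring_on K R)"
  proof (rule ideal_ring_onI)
    show "I \<subseteq> R" using R_closed(4)[OF R_closed(5)[OF _ tR(1)] p_in_R] unfolding I_def by auto
    show "\<zero> \<in> I" using II[OF R_closed(1) p_closed(1)] tR by simp
    fix x assume "x \<in> I"
    then obtain r e where x: "r \<in> R" "e \<in> p" "x = r \<otimes> t \<oplus> e" unfolding I_def by blast
    have xc: "r \<in> carrier K" "e \<in> carrier K" using x R_carrier p_in_R by auto
    show "x \<oplus> y \<in> I" if y0: "y \<in> I" for y
    proof -
      obtain r' e' where y: "r' \<in> R" "e' \<in> p" "y = r' \<otimes> t \<oplus> e'" using y0 unfolding I_def by blast
      have yc: "r' \<in> carrier K" "e' \<in> carrier K" using y R_carrier p_in_R by auto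
      have "x \<oplus> y = (r \<oplus> r') \<otimes> t \<oplus> (e \<oplus> e')" using x(3) y(3) xc yc tR by (simp add: l_distr a_ac)
      then show ?thesis using II[of "r \<oplus> r'" "e \<oplus> e'"] x y R_closed(4) p_closed(2) by simp
    qed
    show "s \<otimes> x \<in> I" if s: "s \<in> R" for s
    proof -
      have "s \<otimes> x = (s \<otimes> r) \<otimes> t \<oplus> s \<otimes> e" using x(3) xc tR R_carrier[OF s] by (simp add: r_distr m_assoc)
      then show ?thesis using II[of "s \<otimes> r" "s \<otimes> e"] x s R_closed(5) p_closed(3) by simp
    qed
  qed
  moreover have "p \<subseteq> I"
  proof
    fix e assume e: "e \<in> p"
    then have "e = \<zero> \<otimes> t \<oplus> e" using tR R_carrier[OF p_in_R[OF e]] by simp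
    then show "e \<in> I" using II[OF R_closed(1) e] by simp
  qed
  moreover have "I \<subseteq> R" using \<open>ideal I (ring_on K R)\<close> ideal.Icarr by fastforce
  moreover have "t \<in> I" using II[OF R_closed(2) p_closed(1)] tR by simp
  ultimately have "I = R" using M.I_maximal[of I] t by auto
  then show ?thesis using that R_closed(2) unfolding I_def by blast
qed

definition denominators :: "'a \<Rightarrow> 'a set" where
  "denominators x = {r \<in> R. r \<otimes> x \<in> R}"

lemma denominators_ideal:
  assumes x: "x \<in> carrier K"
  shows "ideal (denominators x) (ring_on K R)"
proof (rule ideal_ring_onI)
  show "denominators x \<subseteq> R" "\<zero> \<in> denominators x" using x R_closed(1) by (auto simp: denominators_def)
  show "y \<oplus> z \<in> denominators x" if "y \<in> denominators x" "z \<in> denominators x" for y z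
    using that x R_closed(4) R_carrier by (simp add: denominators_def l_distr)
  show "r \<otimes> y \<in> denominators x" if "y \<in> denominators x" "r \<in> R" for y r
    using that x R_closed(5) R_carrier by (simp add: denominators_def m_assoc)
qed

text \<open>Among the ideals of denominators contained in \<open>p\<close> there is a maximal one, since \<open>R\<close> is Noetherian.
  Maximality makes it prime.  As every fraction has a nonzero denominator it is not zero, hence it is
  a maximal ideal by the dimension hypothesis and must be \<open>p\<close>.\<close>

lemma p_is_denominators: "\<exists>x\<in>carrier K. p = denominators x"
proof -
  interpret A: noetherian_domain "ring_on K R" by (rule noetherian)
  obtain a where a: "a \<in> p" "a \<noteq> \<zero>" using nonzero p_closed(1) by auto
  have aK: "a \<in> carrier K - {\<zero>}" using a p_in_R R_carrier by auto
  define D where "D = {denominators x | x. x \<in> carrier K \<and> denominators x \<subseteq> p}"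
  have D: "D \<subseteq> {I. ideal I (ring_on K R)}" using denominators_ideal unfolding D_def by auto
  have "denominators (inv a) \<subseteq> p"
  proof
    fix r assume "r \<in> denominators (inv a)"
    then have r: "r \<in> R" "r \<otimes> inv a \<in> R" by (auto simp: denominators_def)
    have "r = (r \<otimes> inv a) \<otimes> a" using nonzero_inv[OF aK] aK r R_carrier by (simp add: m_assoc)
    then show "r \<in> p" using p_closed(3)[OF a(1) r(2)] by simp
  qed
  then have "denominators (inv a) \<in> D" using nonzero_inv[OF aK] unfolding D_def by blast
  then have "D \<noteq> {}" by blast
  have "\<exists>M\<in>D. \<forall>I\<in>D. M \<subseteq> I \<longrightarrow> I = M"
  proof (rule subset_Zorn_nonempty[OF \<open>D \<noteq> {}\<close>])
    fix C assume C: "C \<noteq> {}" "subset.chain D C"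
    have CD: "C \<subseteq> D" using C(2) by (simp add: subset_chain_def)
    then have "subset.chain {I. ideal I (ring_on K R)} C"
      using C(2) D unfolding subset_chain_def by (meson subset_trans)
    then show "\<Union>C \<in> D" using A.ideal_chain_is_trivial[OF C(1)] CD by blast
  qed
  then obtain M where M: "M \<in> D" "\<And>I. \<lbrakk>I \<in> D; M \<subseteq> I\<rbrakk> \<Longrightarrow> I = M" by auto
  obtain x where x: "x \<in> carrier K" "denominators x \<subseteq> p" and Mx: "M = denominators x"
    using M(1) unfolding D_def by auto
  have max: "denominators y = denominators x"
    if "y \<in> carrier K" "denominators y \<subseteq> p" "denominators x \<subseteq> denominators y" for y
    using M(2)[of "denominators y"] that unfolding Mx D_def by auto
  have mono: "denominators x \<subseteq> denominators (r \<otimes> x)" if "r \<in> R" for r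
  proof
    fix s assume "s \<in> denominators x"
    then have s: "s \<in> R" "s \<otimes> x \<in> R" by (auto simp: denominators_def)
    have "s \<otimes> (r \<otimes> x) = r \<otimes> (s \<otimes> x)" using s that x R_carrier by (simp add: m_ac)
    then show "s \<in> denominators (r \<otimes> x)" using s that R_closed(5) by (simp add: denominators_def)
  qed
  have "primeideal (denominators x) (ring_on K R)"
  proof (intro primeideal.intro primeideal_axioms.intro)
    show "ideal (denominators x) (ring_on K R)" by (rule denominators_ideal[OF x(1)])
    show "cring (ring_on K R)" by (rule cring_R)
    show "carrier (ring_on K R) \<noteq> denominators x" using x(2) one_notin_p R_closed(2) by auto
    fix y z assume "y \<in> carrier (ring_on K R)" "z \<in> carrier (ring_on K R)"
      "y \<otimes>\<^bsub>ring_on K R\<^esub> z \<in> denominators x"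
    then have yz: "y \<in> R" "z \<in> R" "y \<otimes> z \<otimes> x \<in> R" by (auto simp: denominators_def)
    have yzK: "y \<in> carrier K" "z \<in> carrier K" using yz R_carrier by auto
    have zin: "z \<in> denominators (y \<otimes> x)" using yz yzK x by (simp add: denominators_def m_ac)
    show "y \<in> denominators x \<or> z \<in> denominators x"
    proof (cases "denominators (y \<otimes> x) \<subseteq> p")
      case True
      then show ?thesis using max[OF _ True mono] zin yz(1) yzK x by auto
    next
      case False
      \<comment> \<open>Multiplying \<open>x\<close> by such a \<open>t\<close> keeps its denominators inside \<open>p\<close>, hence does not enlarge
        them by maximality; but \<open>y\<close> is a denominator of \<open>t x\<close>.\<close>
      then obtain t where t: "t \<in> R" "t \<notin> p" "t \<otimes> (y \<otimes> x) \<in> R" by (auto simp: denominators_def)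
      have tK: "t \<in> carrier K" using t R_carrier by auto
      have "denominators (t \<otimes> x) \<subseteq> p"
      proof
        fix r assume "r \<in> denominators (t \<otimes> x)"
        then have r: "r \<in> R" "r \<otimes> (t \<otimes> x) \<in> R" by (auto simp: denominators_def)
        then have "r \<otimes> t \<in> p"
          using x tK t R_closed(5) R_carrier
          by (intro subsetD[OF x(2)]) (simp add: denominators_def m_assoc)
        then show "r \<in> p" using units_notin_p_closed(2)[of r t] r t by auto
      qed
      then have "denominators (t \<otimes> x) = denominators x" using max[OF _ _ mono[OF t(1)]] tK x by auto
      moreover have "y \<in> denominators (t \<otimes> x)" using t yz yzK tK x by (simp add: denominators_def m_ac)
      ultimately show ?thesis by simp
    qed
  qed
  moreover have "denominators x \<noteq> {\<zero>}"
  proof -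
    obtain u v where "u \<in> R" "v \<in> R - {\<zero>}" "x = u \<otimes> inv v" using fractions[OF x(1)] by blast
    then have "x \<otimes> v = u" using eq_fraction_iff x(1) R_carrier by auto
    then have "v \<otimes> x \<in> R" using \<open>u \<in> R\<close> \<open>v \<in> R - {\<zero>}\<close> x R_carrier m_comm by (metis DiffD1)
    then have "v \<in> denominators x" using \<open>v \<in> R - {\<zero>}\<close> by (simp add: denominators_def)
    then show ?thesis using \<open>v \<in> R - {\<zero>}\<close> by auto
  qed
  ultimately have m: "maximalideal (denominators x) (ring_on K R)" by (rule prime_imp_maximal)
  have "p = denominators x \<or> p = R"
    using maximalideal.I_maximal[OF m p_ideal x(2)] p_in_R by auto
  then have "p = denominators x" using one_notin_p R_closed(2) by auto
  then show ?thesis using x(1) by blast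
qed

text \<open>An element \<open>x\<close> whose ideal of denominators is \<open>p\<close> behaves like the inverse of a generator of the
  maximal ideal in the localization at \<open>p\<close>.  The uniformizer is therefore taken in the
  field \<open>K\<close>; it need not lie in \<open>R\<close>.\<close>

definition uniformizer :: 'a ("\<varpi>") where
  "\<varpi> = (SOME w. w \<in> carrier K - {\<zero>} \<and> p = denominators (inv w))"

lemma uniformizer: "\<varpi> \<in> carrier K - {\<zero>}" "p = denominators (inv \<varpi>)"
proof -
  obtain x where x: "x \<in> carrier K" "p = denominators x" using p_is_denominators by blast
  have "x \<noteq> \<zero>" using x one_notin_p R_closed by (auto simp: denominators_def)
  then have "inv x \<in> carrier K - {\<zero>} \<and> p = denominators (inv (inv x))" using x nonzero_inv[of x] by auto
  from someI[of "\<lambda>w. w \<in> carrier K - {\<zero>} \<and> p = denominators (inv w)", OF this]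
  show "\<varpi> \<in> carrier K - {\<zero>}" "p = denominators (inv \<varpi>)" by (auto simp: uniformizer_def)
qed

lemma in_p_iff: "r \<in> R \<Longrightarrow> r \<in> p \<longleftrightarrow> r \<otimes> inv \<varpi> \<in> R"
  using uniformizer(2) by (auto simp: denominators_def)

lemma inv_uniformizer: "inv \<varpi> \<in> carrier K" "inv \<varpi> \<noteq> \<zero>" "inv \<varpi> \<notin> R"
  using nonzero_inv[OF uniformizer(1)] in_p_iff[OF R_closed(2)] one_notin_p by auto

text \<open>If \<open>p\<close> were stable under multiplication by the inverse of the uniformizer, then all powers of that inverse would
  have a common denominator, and it would lie in \<open>R\<close>.  So some \<open>g \<in> p\<close> is carried to an \<open>h \<in> R\<close> outside
  \<open>p\<close>.\<close>

lemma uniformizer_fraction: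
  obtains g h where "g \<in> p" "h \<in> R - p" "\<varpi> = g \<otimes> inv h" "h = inv \<varpi> \<otimes> g"
proof -
  have "\<exists>g\<in>p. g \<otimes> inv \<varpi> \<notin> p"
  proof (rule ccontr)
    assume "\<not> ?thesis"
    then have c: "g \<otimes> inv \<varpi> \<in> p" if "g \<in> p" for g using that by blast
    obtain d where d: "d \<in> p" "d \<noteq> \<zero>" using nonzero p_closed(1) by auto
    have dK: "d \<in> carrier K" using d p_in_R R_carrier by auto
    have "inv \<varpi> [^] m \<otimes> d \<in> p" for m :: nat
    proof (induction m)
      case 0 then show ?case using d dK by simp
    next
      case (Suc m)
      have "inv \<varpi> [^] Suc m \<otimes> d = (inv \<varpi> [^] m \<otimes> d) \<otimes> inv \<varpi>"
        using inv_uniformizer dK by (simp add: m_ac)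
      then show ?case using c[OF Suc] by simp
    qed
    then have "inv \<varpi> \<in> R" using inv_uniformizer dK d p_in_R
      by (intro almost_integral_imp_in_R[of "inv \<varpi>" d]) auto
    then show False using inv_uniformizer by simp
  qed
  then obtain g where g: "g \<in> p" "g \<otimes> inv \<varpi> \<notin> p" by blast
  define h where "h = g \<otimes> inv \<varpi>"
  have h: "h \<in> R - p" using g in_p_iff p_in_R by (auto simp: h_def)
  have gK: "g \<in> carrier K" using g p_in_R R_carrier by auto
  have "\<varpi> \<otimes> h = g" using gK uniformizer(1) inv_uniformizer nonzero_inv(3)[OF uniformizer(1)]
    by (simp add: h_def m_lcomm)
  then have "\<varpi> = g \<otimes> inv h" using gK uniformizer(1) notin_p_nonzero[OF h] by (subst eq_fraction_iff) auto
  then show ?thesis using that[OF g(1) h] gK inv_uniformizer(1) by (simp add: h_def m_comm)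
qed

text \<open>With the uniformizer written as \<open>g / h\<close>, multiplying by \<open>g^i \<in> p\<close> would turn membership into \<open>h^i s \<in> p\<close>,
  against primality.\<close>

lemma inv_uniformizer_pow_mult_notin_R:
  assumes s: "s \<in> R - p" and i: "i > (0::nat)"
  shows "inv \<varpi> [^] i \<otimes> s \<notin> R"
proof
  assume a: "inv \<varpi> [^] i \<otimes> s \<in> R"
  obtain g h where gh: "g \<in> p" "h \<in> R - p" "h = inv \<varpi> \<otimes> g" by (rule uniformizer_fraction)
  have c: "g \<in> carrier K" "h \<in> carrier K" "s \<in> carrier K" using gh s p_in_R R_carrier by auto
  have "h [^] i \<otimes> s = g [^] i \<otimes> (inv \<varpi> [^] i \<otimes> s)"
    unfolding gh(3) using c inv_uniformizer by (simp add: nat_pow_distrib m_ac)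
  moreover have "g [^] i \<in> p"
  proof -
    obtain j where "i = Suc j" using i gr0_conv_Suc by auto
    then show ?thesis using gh R_pow[OF p_in_R] p_closed(3) by simp
  qed
  ultimately have "h [^] i \<otimes> s \<in> p" using p_closed(4) a by simp
  then show False using units_notin_p_closed(2)[OF units_notin_p_closed(3)[OF gh(2)] s] by auto
qed

section \<open>The valuation at a nonzero prime\<close>

text \<open>Dividing \<open>u\<close> by the uniformizer must lead out of \<open>R\<close> after finitely many steps, because otherwise \<open>u\<close> would
  be a common denominator for all powers of the inverse of the uniformizer.  The last quotient inside \<open>R\<close> is
  outside \<open>p\<close>, as elements of \<open>p\<close> can be divided once more.\<close>

lemma reduce_to_unit:
  assumes u: "u \<in> R - {\<zero>}"
  obtains m :: nat where "\<And>j. j \<le> m \<Longrightarrow> inv \<varpi> [^] j \<otimes> u \<in> R" "inv \<varpi> [^] m \<otimes> u \<in> R - p"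
proof -
  have uK: "u \<in> carrier K - {\<zero>}" using u R_carrier by auto
  have "\<exists>m::nat. inv \<varpi> [^] m \<otimes> u \<notin> R"
    using almost_integral_imp_in_R[OF inv_uniformizer(1) uK] inv_uniformizer(3) by blast
  then obtain m where m: "inv \<varpi> [^] (m::nat) \<otimes> u \<notin> R" "\<And>j. j < m \<Longrightarrow> inv \<varpi> [^] j \<otimes> u \<in> R"
    using exists_least_iff[of "\<lambda>m. inv \<varpi> [^] m \<otimes> u \<notin> R"] by auto
  have "m \<noteq> 0"
  proof
    assume "m = 0" then show False using m(1) u uK by simp
  qed
  then obtain k where k: "m = Suc k" using not0_implies_Suc by auto
  have "inv \<varpi> [^] Suc k \<otimes> u = (inv \<varpi> [^] k \<otimes> u) \<otimes> inv \<varpi>"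
    using inv_uniformizer uK by (simp add: m_ac)
  then have "inv \<varpi> [^] k \<otimes> u \<notin> p" using m k in_p_iff[OF m(2)[of k]] by auto
  then show ?thesis using that[of k] m(2) k by auto
qed

lemma ideal_pow: "ideal (p [^]\<^bsub>ideals_set (ring_on K R)\<^esub> (n::nat)) (ring_on K R)"
proof -
  interpret A: cring "ring_on K R" by (rule cring_R)
  show ?thesis
  proof (induction n)
    case 0
    then show ?case using A.oneideal by (simp add: ideals_set_def)
  next
    case (Suc n)
    then show ?case using A.ideal_prod_is_ideal[OF Suc p_ideal] by (simp add: ideals_set_def)
  qed
qed

lemma ideal_pow_0: "p [^]\<^bsub>ideals_set (ring_on K R)\<^esub> (0::nat) = R"
  by (simp add: ideals_set_def)

lemma ideal_pow_Suc: "p [^]\<^bsub>ideals_set (ring_on K R)\<^esub> Suc n =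
    ideal_prod (ring_on K R) (p [^]\<^bsub>ideals_set (ring_on K R)\<^esub> n) p"
  by (simp add: ideals_set_def)

text \<open>This and the next lemma say that an element of \<open>R\<close> lies in \<open>p^n\<close> iff it can be divided \<open>n\<close> times by the
  uniformizer within \<open>R\<close>; this connects the order defined by powers of ideals with the uniformizer.\<close>

lemma ideal_pow_imp_denominators:
  "u \<in> p [^]\<^bsub>ideals_set (ring_on K R)\<^esub> (n::nat) \<Longrightarrow> u \<in> carrier K \<and> inv \<varpi> [^] n \<otimes> u \<in> R"
proof (induction n arbitrary: u)
  case 0
  then show ?case using R_carrier unfolding ideal_pow_0 by simp
next
  case (Suc n)
  from Suc.prems show ?case unfolding ideal_pow_Suc
  proof (induction rule: ideal_prod.induct)
    case (prod i j)
    have j: "j \<in> carrier K" "j \<otimes> inv \<varpi> \<in> R" using prod(2) p_in_R R_carrier in_p_iff by auto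
    have i: "i \<in> carrier K" "inv \<varpi> [^] n \<otimes> i \<in> R" using Suc.IH[OF prod(1)] by auto
    have "inv \<varpi> [^] Suc n \<otimes> (i \<otimes> j) = (inv \<varpi> [^] n \<otimes> i) \<otimes> (j \<otimes> inv \<varpi>)"
      using i j inv_uniformizer by (simp add: m_ac)
    then show ?case using i j R_closed(5) by simp
  next
    case (sum s1 s2)
    have "inv \<varpi> [^] Suc n \<otimes> (s1 \<oplus> s2) = inv \<varpi> [^] Suc n \<otimes> s1 \<oplus> inv \<varpi> [^] Suc n \<otimes> s2"
      using sum inv_uniformizer by (intro r_distr) auto
    then show ?case using sum R_closed(4) by simp
  qed
qed

text \<open>By induction, \<open>N\<close> being the new exponent.  If \<open>u / \<varpi>^N\<close> is in \<open>R\<close>, then multiplying by \<open>g^N\<close> shows \<open>h^N u \<in> p^N\<close>.  The factor \<open>h^N\<close>, which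
  is outside \<open>p\<close>, is removed by means of an inverse of it modulo \<open>p\<close>: the error term is \<open>u\<close>, already
  known to be in \<open>p^(N - 1)\<close>, times an element of \<open>p\<close>.\<close>

lemma denominators_imp_ideal_pow:
  assumes "\<And>j. j \<le> n \<Longrightarrow> inv \<varpi> [^] j \<otimes> u \<in> R" and u: "u \<in> R"
  shows "u \<in> p [^]\<^bsub>ideals_set (ring_on K R)\<^esub> (n::nat)"
  using assms(1)
proof (induction n)
  case 0
  show ?case using u unfolding ideal_pow_0 .
next
  case (Suc n)
  let ?P = "\<lambda>n::nat. p [^]\<^bsub>ideals_set (ring_on K R)\<^esub> n"
  have un: "u \<in> ?P n" using Suc by simp
  define N where "N = Suc n"
  obtain g h where gh: "g \<in> p" "h \<in> R - p" "h = inv \<varpi> \<otimes> g" by (rule uniformizer_fraction)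
  have c: "g \<in> carrier K" "h \<in> carrier K" "u \<in> carrier K" using gh u p_in_R R_carrier by auto
  have "g [^] m \<in> ?P m" for m :: nat
  proof (induction m)
    case 0 show ?case using R_closed(2) unfolding ideal_pow_0 by simp
  next
    case (Suc m)
    have "g [^] m \<otimes>\<^bsub>ring_on K R\<^esub> g \<in> ?P (Suc m)" unfolding ideal_pow_Suc
      by (rule ideal_prod.prod[OF Suc gh(1)])
    then show ?case by simp
  qed
  then have "(inv \<varpi> [^] N \<otimes> u) \<otimes> g [^] N \<in> ?P N"
    using ideal.I_l_closed[OF ideal_pow, of "g [^] N" N "inv \<varpi> [^] N \<otimes> u"] Suc.prems[of N]
    by (simp add: N_def[symmetric])
  moreover have "(inv \<varpi> [^] N \<otimes> u) \<otimes> g [^] N = h [^] N \<otimes> u"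
    unfolding gh(3) using c inv_uniformizer by (simp add: nat_pow_distrib m_ac)
  ultimately have hu: "h [^] N \<otimes> u \<in> ?P N" by simp
  obtain t e where te: "t \<in> R" "e \<in> p" "\<one> = t \<otimes> h [^] N \<oplus> e"
    using inverse_mod_p[OF units_notin_p_closed(3)[OF gh(2)]] by metis
  have tec: "t \<in> carrier K" "e \<in> carrier K" using te p_in_R R_carrier by auto
  have "u = (t \<otimes> h [^] N \<oplus> e) \<otimes> u" using te(3)[symmetric] c by simp
  also have "\<dots> = t \<otimes> (h [^] N \<otimes> u) \<oplus> u \<otimes> e"
    using tec c by (simp add: r_distr m_ac)
  finally have ueq: "u = t \<otimes> (h [^] N \<otimes> u) \<oplus> u \<otimes> e" .
  have 1: "t \<otimes> (h [^] N \<otimes> u) \<in> ?P N"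
    using ideal.I_l_closed[OF ideal_pow hu, of t] te(1) by simp
  have 2: "u \<otimes> e \<in> ?P N"
    using ideal_prod.prod[OF un te(2), of "ring_on K R"] unfolding N_def ideal_pow_Suc by simp
  have "t \<otimes> (h [^] N \<otimes> u) \<oplus> u \<otimes> e \<in> ?P N"
    using additive_subgroup.a_closed[OF ideal.axioms(1)[OF ideal_pow] 1 2] by simp
  then show ?case using ueq unfolding N_def by metis
qed

lemma padic_ord_reduces:
  assumes u: "u \<in> R - {\<zero>}"
  shows "inv \<varpi> [^] padic_ord K R p u \<otimes> u \<in> R - p"
proof -
  obtain m :: nat where m: "\<And>j. j \<le> m \<Longrightarrow> inv \<varpi> [^] j \<otimes> u \<in> R" "inv \<varpi> [^] m \<otimes> u \<in> R - p"
    using reduce_to_unit[OF u] by metis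
  have uK: "u \<in> carrier K" using u R_carrier by auto
  have "padic_ord K R p u = m" unfolding padic_ord_def
  proof (rule Greatest_equality)
    show "u \<in> p [^]\<^bsub>ideals_set (ring_on K R)\<^esub> m" using denominators_imp_ideal_pow m(1) u by blast
    fix j :: nat assume "u \<in> p [^]\<^bsub>ideals_set (ring_on K R)\<^esub> j"
    then have j: "inv \<varpi> [^] j \<otimes> u \<in> R" using ideal_pow_imp_denominators by blast
    show "j \<le> m"
    proof (rule ccontr)
      assume "\<not> j \<le> m"
      then obtain i where i: "j = i + m" "i > 0" by (metis add.commute less_imp_add_positive not_le)
      have "inv \<varpi> [^] j \<otimes> u = inv \<varpi> [^] i \<otimes> (inv \<varpi> [^] m \<otimes> u)"
        using uK inv_uniformizer unfolding i by (simp add: nat_pow_mult[symmetric] m_assoc)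
      then show False using inv_uniformizer_pow_mult_notin_R[OF m(2) i(2)] j by simp
    qed
  qed
  then show ?thesis using m(2) by simp
qed

text \<open>The units of the localization of \<open>R\<close> at \<open>p\<close>, realized inside \<open>K\<close>.\<close>

definition local_units :: "'a set" where
  "local_units = {s \<otimes> inv t | s t. s \<in> R - p \<and> t \<in> R - p}"

lemma local_unitsI: "\<lbrakk>s \<in> R - p; t \<in> R - p\<rbrakk> \<Longrightarrow> s \<otimes> inv t \<in> local_units"
  unfolding local_units_def by blast

lemma local_unitsE:
  assumes "e \<in> local_units"
  obtains s t where "s \<in> R - p" "t \<in> R - p" "e = s \<otimes> inv t"
  using assms unfolding local_units_def by blast

lemma local_units_nonzero: "e \<in> local_units \<Longrightarrow> e \<in> carrier K - {\<zero>}"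
proof (elim local_unitsE)
  fix s t assume "s \<in> R - p" "t \<in> R - p" "e = s \<otimes> inv t"
  then show ?thesis
    using nonzero_m_closed[OF notin_p_nonzero, of s "inv t"] nonzero_inv(1,2)[OF notin_p_nonzero, of t]
      by simp
qed

lemma local_units_mult: "\<lbrakk>e \<in> local_units; f \<in> local_units\<rbrakk> \<Longrightarrow> e \<otimes> f \<in> local_units"
proof (elim local_unitsE)
  fix s t s' t'
  assume a: "s \<in> R - p" "t \<in> R - p" "e = s \<otimes> inv t" "s' \<in> R - p" "t' \<in> R - p" "f = s' \<otimes> inv t'"
  have "e \<otimes> f = (s \<otimes> s') \<otimes> inv (t \<otimes> t')"
    using a notin_p_nonzero[of s] notin_p_nonzero[of t] notin_p_nonzero[of s'] notin_p_nonzero[of t']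
      fraction_mult by auto
  then show ?thesis using local_unitsI units_notin_p_closed(2) a by auto
qed

lemma local_units_inv: "e \<in> local_units \<Longrightarrow> inv e \<in> local_units"
proof (elim local_unitsE)
  fix s t assume a: "s \<in> R - p" "t \<in> R - p" "e = s \<otimes> inv t"
  note n = notin_p_nonzero[OF a(1)] notin_p_nonzero[OF a(2)]
  have "inv e = inv s \<otimes> inv (inv t)" unfolding a(3) using n nonzero_inv[OF n(2)] by (intro inv_of_mult) auto
  then have "inv e = t \<otimes> inv s" using n nonzero_inv[OF n(2)] nonzero_inv(1)[OF n(1)] by (simp add: m_comm)
  then show ?thesis using local_unitsI a by auto
qed

lemma inv_uniformizer_pow_notin_local_units:
  assumes "i > (0::nat)" shows "inv \<varpi> [^] i \<notin> local_units"
proof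
  assume "inv \<varpi> [^] i \<in> local_units"
  then obtain s t where st: "s \<in> R - p" "t \<in> R - p" "inv \<varpi> [^] i = s \<otimes> inv t" by (rule local_unitsE)
  have "inv \<varpi> [^] i \<otimes> t = s"
    using notin_p_nonzero[OF st(1)] notin_p_nonzero[OF st(2)] inv_uniformizer(1) st(3)
      eq_fraction_iff[of "inv \<varpi> [^] i" s t] by simp
  then show False using inv_uniformizer_pow_mult_notin_R[OF st(2) assms] st(1) by simp
qed

lemma uniformizer_int_pow_neg: "\<varpi> [^] (- int i) = inv \<varpi> [^] i"
proof -
  have "\<varpi> [^] i \<otimes> inv \<varpi> [^] i = \<one>" using uniformizer(1) inv_uniformizer nonzero_inv(3)[OF uniformizer(1)]
    by (simp add: nat_pow_distrib[symmetric])
  then have "inv (\<varpi> [^] i) = inv \<varpi> [^] i" using uniformizer(1) inv_uniformizer by (intro comm_inv_char) auto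
  then show ?thesis using int_pow_uminus[OF uniformizer(1), of "int i"] by (simp add: int_pow_int)
qed

lemma uniformizer_pow_local_units_imp_0:
  assumes "\<varpi> [^] (m::int) \<in> local_units" shows "m = 0"
proof (rule ccontr)
  assume "m \<noteq> 0"
  then consider i where "i > 0" "m = - int i" | i where "i > 0" "m = int i"
    by (metis int_cases2 of_nat_0_less_iff of_nat_0 neg_equal_0_iff_equal gr0I)
  then show False
  proof cases
    case 1
    then show ?thesis
      using assms inv_uniformizer_pow_notin_local_units[of i] uniformizer_int_pow_neg[of i] by simp
  next
    case 2
    then show ?thesis
      using local_units_inv[OF assms] inv_uniformizer_pow_notin_local_units[of i] uniformizer_int_pow_neg[of
      i]
      int_pow_uminus[OF uniformizer(1), of m] by simp
  qed
qed

abbreviation upow :: "int \<Rightarrow> 'a" where "upow m \<equiv> \<varpi> [^] m"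

lemma upow_carrier: "upow m \<in> carrier K" "upow m \<noteq> \<zero>"
  using int_pow_nonzero[OF uniformizer(1)] by auto

lemma upow_cancel: "x \<in> carrier K \<Longrightarrow> upow (- m) \<otimes> (upow m \<otimes> x) = x"
  using upow_carrier int_pow_minus_mult[OF uniformizer(1), of m] by (simp add: m_assoc[symmetric])

lemma upow_cancel2: "x \<in> carrier K \<Longrightarrow> upow m \<otimes> (upow (- m) \<otimes> x) = x"
  using upow_cancel[of x "- m"] by simp

lemma upow_mult: "\<lbrakk>x \<in> carrier K; y \<in> carrier K\<rbrakk> \<Longrightarrow> (upow m \<otimes> x) \<otimes> (upow n \<otimes> y) = upow (m + n) \<otimes> (x \<otimes> y)"
  using upow_carrier int_pow_add[OF uniformizer(1)] by (simp add: m_ac)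

text \<open>A power of the uniformizer with nonzero exponent is not a unit of the localization, so the exponent in
  a decomposition into such a power and a unit is unique.\<close>

lemma upow_local_unit_unique:
  assumes "e \<in> local_units" "f \<in> local_units" "upow m \<otimes> e = upow n \<otimes> f"
  shows "m = n"
proof -
  note c = local_units_nonzero[OF assms(1)] local_units_nonzero[OF assms(2)]
  have "upow (m - n) \<otimes> e = upow (-n) \<otimes> (upow m \<otimes> e)"
    using c upow_carrier int_pow_add[OF uniformizer(1), of "- n" m] by (simp add: m_assoc)
  also have "\<dots> = f" using assms(3) upow_cancel c by simp
  finally have "upow (m - n) = f \<otimes> inv e" using c upow_carrier by (subst eq_fraction_iff) auto
  then have "upow (m - n) \<in> local_units" using local_units_mult local_units_inv assms by auto
  then show ?thesis using uniformizer_pow_local_units_imp_0 by fastforce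
qed

lemma padic_ord_decomp:
  assumes u: "u \<in> R - {\<zero>}"
  obtains s where "s \<in> R - p" "u = upow (int (padic_ord K R p u)) \<otimes> s"
proof -
  let ?n = "int (padic_ord K R p u)"
  have "upow (- ?n) \<otimes> u \<in> R - p" using padic_ord_reduces[OF u] by (simp add: uniformizer_int_pow_neg)
  moreover have "u = upow ?n \<otimes> (upow (- ?n) \<otimes> u)" using u R_carrier upow_cancel2 by simp
  ultimately show ?thesis using that by blast
qed

abbreviation val :: "'a \<Rightarrow> int" where "val \<equiv> padic_val K R p"

lemma fraction_decomp:
  assumes "u \<in> R - {\<zero>}" "v \<in> R - {\<zero>}"
  obtains e where "e \<in> local_units"
    "u \<otimes> inv v = upow (int (padic_ord K R p u) - int (padic_ord K R p v)) \<otimes> e"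
proof -
  let ?m = "int (padic_ord K R p u)" and ?n = "int (padic_ord K R p v)"
  obtain s where s: "s \<in> R - p" "u = upow ?m \<otimes> s" by (rule padic_ord_decomp[OF assms(1)])
  obtain t where t: "t \<in> R - p" "v = upow ?n \<otimes> t" by (rule padic_ord_decomp[OF assms(2)])
  note c = notin_p_nonzero[OF s(1)] notin_p_nonzero[OF t(1)]
  have "inv v = upow (- ?n) \<otimes> inv t"
    using t(2) inv_of_mult[of "upow ?n" t] c upow_carrier int_pow_uminus[OF uniformizer(1), of ?n] by auto
  then have "u \<otimes> inv v = upow (?m - ?n) \<otimes> (s \<otimes> inv t)"
    using upow_mult[of s "inv t" ?m "- ?n"] s(2) c nonzero_inv(1)[OF c(2)] by auto
  then show ?thesis using that local_unitsI s t by blast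
qed

text \<open>Every fraction representing \<open>x\<close> yields a decomposition of \<open>x\<close> whose exponent is the difference of
  the orders.  By uniqueness of the exponent, that difference does not depend on the fraction, which is
  what the definite description in the definition of the valuation requires.\<close>

lemma padic_val_unfold:
  assumes x: "x \<in> carrier K - {\<zero>}"
  obtains e where "e \<in> local_units" "x = upow (val x) \<otimes> e"
proof -
  obtain u v where uv: "u \<in> R" "v \<in> R - {\<zero>}" "x = u \<otimes> inv v" using fractions x by blast
  have "u \<noteq> \<zero>" using uv x nonzero_inv(1)[of v] R_carrier by auto
  then have u: "u \<in> R - {\<zero>}" using uv by simp
  let ?m = "int (padic_ord K R p u) - int (padic_ord K R p v)"
  obtain e where e: "e \<in> local_units" "x = upow ?m \<otimes> e"
    using fraction_decomp[OF u uv(2)] uv(3) by metis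
  have "val x = ?m" unfolding padic_val_def
  proof (rule the_equality)
    fix m assume "\<exists>u\<in>R - {\<zero>}. \<exists>v\<in>R - {\<zero>}. x = u \<otimes> inv v \<and> m = int (padic_ord K R p u) - int (padic_ord K R p v)"
    then obtain u' v' where u': "u' \<in> R - {\<zero>}" "v' \<in> R - {\<zero>}" "x = u' \<otimes> inv v'"
      "m = int (padic_ord K R p u') - int (padic_ord K R p v')" by blast
    obtain e' where e': "e' \<in> local_units" "x = upow m \<otimes> e'"
      using fraction_decomp[OF u'(1,2)] u'(3,4) by metis
    show "m = ?m" using upow_local_unit_unique[OF e'(1) e(1)] e(2) e'(2) by simp
  qed (use u uv in blast)
  then show ?thesis using that e by simp
qed

lemma val_eqI: "e \<in> local_units \<Longrightarrow> val (upow m \<otimes> e) = m"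
proof -
  assume e: "e \<in> local_units"
  then have "upow m \<otimes> e \<in> carrier K - {\<zero>}" using local_units_nonzero upow_carrier nonzero_m_closed by blast
  then obtain f where "f \<in> local_units" "upow m \<otimes> e = upow (val (upow m \<otimes> e)) \<otimes> f"
    by (rule padic_val_unfold)
  then show ?thesis using upow_local_unit_unique e by metis
qed

section \<open>Residues and angular components\<close>

abbreviation F where "F \<equiv> residue_field K R p"

lemma field_F: "field F"
  unfolding residue_field_def
  by (rule maximalideal.quotient_is_field[OF prime_imp_maximal[OF prime nonzero] cring_R])

sublocale F: field F by (rule field_F)

abbreviation coset :: "'a \<Rightarrow> 'a set" where "coset u \<equiv> p +>\<^bsub>ring_on K R\<^esub> u"

lemma coset_hom: "coset \<in> ring_hom (ring_on K R) F"
  unfolding residue_field_def by (rule ideal.rcos_ring_hom[OF p_ideal])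

lemma coset_simps:
  "u \<in> R \<Longrightarrow> coset u \<in> carrier F"
  "\<lbrakk>u \<in> R; v \<in> R\<rbrakk> \<Longrightarrow> coset (u \<otimes> v) = coset u \<otimes>\<^bsub>F\<^esub> coset v"
  "\<lbrakk>u \<in> R; v \<in> R\<rbrakk> \<Longrightarrow> coset (u \<oplus> v) = coset u \<oplus>\<^bsub>F\<^esub> coset v"
  "coset \<one> = \<one>\<^bsub>F\<^esub>"
  using ring_hom_closed[OF coset_hom] ring_hom_mult[OF coset_hom] ring_hom_add[OF coset_hom] ring_hom_one[OF
    coset_hom]
  by simp_all

lemma coset_zero_iff: "u \<in> R \<Longrightarrow> coset u = \<zero>\<^bsub>F\<^esub> \<longleftrightarrow> u \<in> p"
proof -
  assume u: "u \<in> R"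
  have "\<zero>\<^bsub>F\<^esub> = p" by (simp add: residue_field_def FactRing_def)
  then show ?thesis
    using ideal.rcos_const_imp_mem[OF p_ideal, of u] abelian_subgroup.a_rcos_const[OF abelian_subgroupI3[OF
      ideal.axioms(1)[OF p_ideal] ring.is_abelian_group[OF cring.axioms(1)[OF cring_R]]], of u] u
    by auto
qed

lemma coset_nonzero: "u \<in> R - p \<Longrightarrow> coset u \<in> carrier F - {\<zero>\<^bsub>F\<^esub>}"
  using coset_simps(1) coset_zero_iff by auto

text \<open>The localization of \<open>R\<close> at \<open>p\<close>, realized inside \<open>K\<close>; it is the domain on which residues are defined.\<close>

definition local_ring :: "'a set" where
  "local_ring = {u \<otimes> inv v | u v. u \<in> R \<and> v \<in> R - p}"

lemma local_ringI: "\<lbrakk>u \<in> R; v \<in> R - p\<rbrakk> \<Longrightarrow> u \<otimes> inv v \<in> local_ring"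
  unfolding local_ring_def by blast

lemma local_ringE:
  assumes "x \<in> local_ring"
  obtains u v where "u \<in> R" "v \<in> R - p" "x = u \<otimes> inv v"
  using assms unfolding local_ring_def by blast

lemma local_ring_carrier: "x \<in> local_ring \<Longrightarrow> x \<in> carrier K"
proof (elim local_ringE)
  fix u v assume "u \<in> R" "v \<in> R - p" "x = u \<otimes> inv v"
  then show ?thesis using R_carrier nonzero_inv(1)[OF notin_p_nonzero, of v] by simp
qed

abbreviation res :: "'a \<Rightarrow> 'a set" where "res \<equiv> residue_mod K R p"

lemma res_fraction:
  assumes u: "u \<in> R" and v: "v \<in> R - p"
  shows "res (u \<otimes> inv v) = coset u \<otimes>\<^bsub>F\<^esub> inv\<^bsub>F\<^esub> coset v"
  unfolding residue_mod_def
proof (rule the_equality)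
  fix r assume "\<exists>u'\<in>R. \<exists>v'\<in>R - p. u \<otimes> inv v = u' \<otimes> inv v' \<and> r = coset u' \<otimes>\<^bsub>F\<^esub> inv\<^bsub>F\<^esub> coset v'"
  then obtain u' v' where uv: "u' \<in> R" "v' \<in> R - p" "u \<otimes> inv v = u' \<otimes> inv v'"
    "r = coset u' \<otimes>\<^bsub>F\<^esub> inv\<^bsub>F\<^esub> coset v'" by blast
  then have "u \<otimes> v' = u' \<otimes> v"
    using fraction_eq_iff u R_carrier notin_p_nonzero[OF v] notin_p_nonzero[of v'] by auto
  then have "coset u \<otimes>\<^bsub>F\<^esub> coset v' = coset u' \<otimes>\<^bsub>F\<^esub> coset v" using u v uv coset_simps(2) by (metis DiffD1)
  then show "r = coset u \<otimes>\<^bsub>F\<^esub> inv\<^bsub>F\<^esub> coset v"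
    using F.fraction_eq_iff[of "coset u" "coset v" "coset u'" "coset v'"] u uv coset_simps(1)
      coset_nonzero[OF v] coset_nonzero[of v'] by simp
qed (use assms in blast)

lemma local_ring_hom:
  assumes "x \<in> local_ring" "y \<in> local_ring"
  shows "res x \<in> carrier F" "x \<oplus> y \<in> local_ring" "res (x \<oplus> y) = res x \<oplus>\<^bsub>F\<^esub> res y"
    "x \<otimes> y \<in> local_ring" "res (x \<otimes> y) = res x \<otimes>\<^bsub>F\<^esub> res y"
proof -
  obtain u v where x: "u \<in> R" "v \<in> R - p" "x = u \<otimes> inv v" using assms(1) by (rule local_ringE)
  obtain s t where y: "s \<in> R" "t \<in> R - p" "y = s \<otimes> inv t" using assms(2) by (rule local_ringE)
  have R: "v \<in> R" "t \<in> R" using x y by auto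
  note c = R_carrier[OF x(1)] notin_p_nonzero[OF x(2)] R_carrier[OF y(1)] notin_p_nonzero[OF y(2)]
  note d = coset_simps(1)[OF x(1)] coset_nonzero[OF x(2)] coset_simps(1)[OF y(1)] coset_nonzero[OF y(2)]
  have vt: "v \<otimes> t \<in> R - p" using units_notin_p_closed(2) x y by auto
  show "res x \<in> carrier F" unfolding x(3) res_fraction[OF x(1,2)] using d F.nonzero_inv(1)[OF d(2)] by simp
  have s: "x \<oplus> y = (u \<otimes> t \<oplus> s \<otimes> v) \<otimes> inv (v \<otimes> t)" unfolding x(3) y(3) using c by (rule fraction_add)
  have N: "u \<otimes> t \<oplus> s \<otimes> v \<in> R" using x y R R_closed by simp
  show "x \<oplus> y \<in> local_ring" unfolding s using N vt by (rule local_ringI)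
  show "res (x \<oplus> y) = res x \<oplus>\<^bsub>F\<^esub> res y"
    unfolding s res_fraction[OF N vt]
      unfolding x(3) y(3) res_fraction[OF x(1,2)] res_fraction[OF y(1,2)] F.fraction_add[OF d]
    using x(1) y(1) R R_closed by (simp add: coset_simps)
  have m: "x \<otimes> y = (u \<otimes> s) \<otimes> inv (v \<otimes> t)" unfolding x(3) y(3) using c by (rule fraction_mult)
  have M: "u \<otimes> s \<in> R" using x y R_closed by simp
  show "x \<otimes> y \<in> local_ring" unfolding m using M vt by (rule local_ringI)
  show "res (x \<otimes> y) = res x \<otimes>\<^bsub>F\<^esub> res y"
    unfolding m res_fraction[OF M vt]
      unfolding x(3) y(3) res_fraction[OF x(1,2)] res_fraction[OF y(1,2)] F.fraction_mult[OF d]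
    using x(1) y(1) R R_closed by (simp add: coset_simps)
qed

lemma res_eq_zero_iff:
  assumes "u \<in> R" "v \<in> R - p"
  shows "res (u \<otimes> inv v) = \<zero>\<^bsub>F\<^esub> \<longleftrightarrow> u \<in> p"
  using assms res_fraction coset_simps(1)[of u] coset_nonzero[of v] F.nonzero_inv[of "coset v"]
    F.integral_iff coset_zero_iff
  by auto

lemma local_units_iff: "e \<in> local_units \<longleftrightarrow> e \<in> local_ring \<and> res e \<noteq> \<zero>\<^bsub>F\<^esub>"
proof
  assume "e \<in> local_units"
  then obtain s t where "s \<in> R - p" "t \<in> R - p" "e = s \<otimes> inv t" by (rule local_unitsE)
  then show "e \<in> local_ring \<and> res e \<noteq> \<zero>\<^bsub>F\<^esub>" using res_eq_zero_iff[of s t] local_ringI[of s t] by auto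
next
  assume a: "e \<in> local_ring \<and> res e \<noteq> \<zero>\<^bsub>F\<^esub>"
  then obtain u v where "u \<in> R" "v \<in> R - p" "e = u \<otimes> inv v" using local_ringE by blast
  then show "e \<in> local_units" using res_eq_zero_iff[of u v] local_unitsI a by auto
qed

lemma R_local_ring:
  assumes "u \<in> R" shows "u \<in> local_ring" "res u = coset u"
proof -
  have e: "u = u \<otimes> inv \<one>" using assms R_carrier by simp
  show "u \<in> local_ring" using local_ringI[OF assms units_notin_p_closed(1)] e by simp
  show "res u = coset u" using res_fraction[OF assms units_notin_p_closed(1)] e coset_simps(1)[OF assms]
    by (simp add: coset_simps(4))
qed

lemma uniformizer_res: "\<varpi> \<in> local_ring" "res \<varpi> = \<zero>\<^bsub>F\<^esub>"
proof -
  obtain g h where "g \<in> p" "h \<in> R - p" "\<varpi> = g \<otimes> inv h" by (rule uniformizer_fraction)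
  then show "\<varpi> \<in> local_ring" "res \<varpi> = \<zero>\<^bsub>F\<^esub>" using local_ringI[of g h] res_eq_zero_iff[of g h] p_in_R by auto
qed

lemma upow_res: "m > 0 \<Longrightarrow> upow m \<in> local_ring \<and> res (upow m) = \<zero>\<^bsub>F\<^esub>"
proof -
  have "upow (int (Suc n)) \<in> local_ring \<and> res (upow (int (Suc n))) = \<zero>\<^bsub>F\<^esub>" for n
  proof (induction n)
    case 0
    have "upow (int (Suc 0)) = \<varpi>" using uniformizer(1) by (subst int_pow_int) simp
    then show ?case using uniformizer_res by simp
  next
    case (Suc n)
    have "upow (int (Suc (Suc n))) = upow (int (Suc n)) \<otimes> \<varpi>" by (simp only: int_pow_int nat_pow_Suc)
    then show ?case using Suc local_ring_hom(4,5)[of "upow (int (Suc n))" \<varpi>] uniformizer_res by simp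
  qed
  from this[of "nat (m - 1)"] show "m > 0 \<Longrightarrow> upow m \<in> local_ring \<and> res (upow m) = \<zero>\<^bsub>F\<^esub>"
    by (simp add: Suc_nat_eq_nat_zadd1)
qed

lemma local_ring_val:
  assumes x: "x \<in> local_ring" "x \<noteq> \<zero>"
  shows "val x \<ge> 0" "res x = \<zero>\<^bsub>F\<^esub> \<Longrightarrow> val x > 0"
proof -
  obtain u v where uv: "u \<in> R" "v \<in> R - p" "x = u \<otimes> inv v" using x(1) by (rule local_ringE)
  have "x \<in> carrier K - {\<zero>}" using x local_ring_carrier by simp
  then obtain e where e: "e \<in> local_units" "x = upow (val x) \<otimes> e" by (rule padic_val_unfold)
  have eK: "e \<in> carrier K" "e \<noteq> \<zero>" using local_units_nonzero e by auto
  show "val x \<ge> 0"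
  proof (rule ccontr)
    assume n: "\<not> val x \<ge> 0"
    have "upow (- val x) \<otimes> x = e" using upow_cancel[OF eK(1), of "val x"] e(2) by simp
    then have "res e = \<zero>\<^bsub>F\<^esub>"
      using local_ring_hom(5)[of "upow (- val x)" x] upow_res[of "- val x"] n x local_ring_hom(1)[of x x]
      by simp
    then show False using e local_units_iff by simp
  qed
  moreover have "val x \<noteq> 0" if "res x = \<zero>\<^bsub>F\<^esub>"
  proof
    assume "val x = 0"
    then have "x = e" using e(2) eK by simp
    then show False using e local_units_iff that by simp
  qed
  ultimately show "res x = \<zero>\<^bsub>F\<^esub> \<Longrightarrow> val x > 0" by fastforce
qed

text \<open>The angular component: the residue of \<open>x\<close> after its power of the uniformizer is divided out, that is, the
  leading coefficient of the expansion of \<open>x\<close> in powers of the uniformizer.\<close>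

definition ac :: "'a \<Rightarrow> 'a set" where
  "ac x = res (upow (- val x) \<otimes> x)"

lemma ac_eqI: "e \<in> local_units \<Longrightarrow> ac (upow m \<otimes> e) = res e"
  using val_eqI[of e m] upow_cancel local_units_nonzero by (simp add: ac_def)

lemma val_ac_eqI:
  assumes "e \<in> local_units" "x = upow m \<otimes> e"
  shows "x \<noteq> \<zero> \<and> val x = m \<and> ac x = res e"
  using val_eqI[OF assms(1), of m] ac_eqI[OF assms(1), of m] local_units_nonzero[OF assms(1)]
    upow_carrier[of m] integral[of "upow m" e] assms(2) by auto

lemma val_ac_decomp:
  assumes x: "x \<in> carrier K - {\<zero>}"
  obtains e where "e \<in> local_units" "e \<in> local_ring" "x = upow (val x) \<otimes> e" "ac x = res e"
  using padic_val_unfold[OF x] ac_eqI local_units_iff by metis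

lemma ac_nonzero: "x \<in> carrier K - {\<zero>} \<Longrightarrow> ac x \<in> carrier F - {\<zero>\<^bsub>F\<^esub>}"
  using val_ac_decomp[of x] local_units_iff local_ring_hom(1) by (metis DiffI singletonD)

lemma val_ac_mult:
  assumes "x \<in> carrier K - {\<zero>}" "y \<in> carrier K - {\<zero>}"
  shows "val (x \<otimes> y) = val x + val y" "ac (x \<otimes> y) = ac x \<otimes>\<^bsub>F\<^esub> ac y"
proof -
  obtain e where e: "e \<in> local_units" "e \<in> local_ring" "x = upow (val x) \<otimes> e" "ac x = res e"
    by (rule val_ac_decomp[OF assms(1)])
  obtain f where f: "f \<in> local_units" "f \<in> local_ring" "y = upow (val y) \<otimes> f" "ac y = res f"
    by (rule val_ac_decomp[OF assms(2)])
  have "x \<otimes> y = upow (val x + val y) \<otimes> (e \<otimes> f)"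
    using e(3) f(3) upow_mult[of e f "val x" "val y"] local_ring_carrier e(2) f(2) by simp
  then show "val (x \<otimes> y) = val x + val y" "ac (x \<otimes> y) = ac x \<otimes>\<^bsub>F\<^esub> ac y"
    using val_eqI[OF local_units_mult[OF e(1) f(1)]] ac_eqI[OF local_units_mult[OF e(1) f(1)]]
      local_ring_hom(5)[OF e(2) f(2)] e(4) f(4) by simp_all
qed

lemma val_ac_unit:
  assumes "s \<in> R - p" shows "val s = 0" "ac s = coset s"
proof -
  have "s \<in> local_units" using assms R_local_ring[of s] coset_zero_iff local_units_iff by auto
  moreover have "upow 0 \<otimes> s = s" using assms R_carrier by simp
  ultimately show "val s = 0" "ac s = coset s"
    using val_eqI[of s 0] ac_eqI[of s 0] R_local_ring[of s] assms by auto
qed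

lemma val_ac_pow:
  assumes "x \<in> carrier K - {\<zero>}"
  shows "ac (x [^] (n::nat)) = ac x [^]\<^bsub>F\<^esub> n"
proof (induction n)
  case 0
  then show ?case using val_ac_unit(2)[OF units_notin_p_closed(1)] coset_simps(4) by simp
next
  case (Suc n)
  then show ?case using val_ac_mult(2)[OF nonzero_pow_closed[OF assms, of n] assms] by simp
qed

text \<open>Sums of decomposed elements: the smaller power is factored out, and what remains of the other summand has
  residue zero unless the exponents agree.\<close>

lemma upow_add_decomp:
  assumes le: "m \<le> n" and e: "e \<in> local_ring" and f: "f \<in> local_ring"
  obtains g where "g \<in> local_ring" "upow m \<otimes> e \<oplus> upow n \<otimes> f = upow m \<otimes> g"
    "res g = (if m = n then res e \<oplus>\<^bsub>F\<^esub> res f else res e)"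
proof -
  note c = local_ring_carrier[OF e] local_ring_carrier[OF f]
  have "upow n = upow m \<otimes> upow (n - m)" using int_pow_add[OF uniformizer(1), of m "n - m"] by simp
  then have eq: "upow m \<otimes> e \<oplus> upow n \<otimes> f = upow m \<otimes> (e \<oplus> upow (n - m) \<otimes> f)"
    using c upow_carrier by (simp add: r_distr m_assoc)
  show ?thesis
  proof (cases "m = n")
    case True
    then show ?thesis using that[of "e \<oplus> f"] local_ring_hom[OF e f] eq c by simp
  next
    case False
    then have w: "upow (n - m) \<in> local_ring" "res (upow (n - m)) = \<zero>\<^bsub>F\<^esub>"
      using upow_res[of "n - m"] le by auto
    have "upow (n - m) \<otimes> f \<in> local_ring" "res (upow (n - m) \<otimes> f) = \<zero>\<^bsub>F\<^esub>"
      using local_ring_hom[OF w(1) f] w local_ring_hom(1)[OF f f] by simp_all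
    then show ?thesis using that[OF _ eq] local_ring_hom[OF e, of "upow (n - m) \<otimes> f"] False by simp
  qed
qed

lemma val_ac_add_less:
  assumes "x \<in> carrier K - {\<zero>}" "y \<in> carrier K" "y = \<zero> \<or> val x < val y"
  shows "x \<oplus> y \<noteq> \<zero>" "val (x \<oplus> y) = val x" "ac (x \<oplus> y) = ac x"
proof -
  have "x \<oplus> y \<noteq> \<zero> \<and> val (x \<oplus> y) = val x \<and> ac (x \<oplus> y) = ac x"
  proof (cases "y = \<zero>")
    case True then show ?thesis using assms by simp
  next
    case False
    then have y: "y \<in> carrier K - {\<zero>}" "val x < val y" using assms by auto
    obtain e where e: "e \<in> local_units" "e \<in> local_ring" "x = upow (val x) \<otimes> e" "ac x = res e"
      by (rule val_ac_decomp[OF assms(1)])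
    obtain f where f: "f \<in> local_units" "f \<in> local_ring" "y = upow (val y) \<otimes> f" "ac y = res f"
      by (rule val_ac_decomp[OF y(1)])
    obtain g where g: "g \<in> local_ring" "x \<oplus> y = upow (val x) \<otimes> g" "res g = res e"
      using upow_add_decomp[OF less_imp_le[OF y(2)] e(2) f(2)] y(2) e(3) f(3) by (metis less_irrefl)
    have gu: "g \<in> local_units" using g e local_units_iff by simp
    show ?thesis using val_ac_eqI[OF gu g(2)] g(3) e(4) by simp
  qed
  then show "x \<oplus> y \<noteq> \<zero>" "val (x \<oplus> y) = val x" "ac (x \<oplus> y) = ac x" by auto
qed

lemma val_ac_add_equal:
  assumes "x \<in> carrier K - {\<zero>}" "y \<in> carrier K - {\<zero>}" "val x = val y" "ac x \<oplus>\<^bsub>F\<^esub> ac y \<noteq> \<zero>\<^bsub>F\<^esub>"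
  shows "x \<oplus> y \<noteq> \<zero>" "val (x \<oplus> y) = val x" "ac (x \<oplus> y) = ac x \<oplus>\<^bsub>F\<^esub> ac y"
proof -
  obtain e where e: "e \<in> local_units" "e \<in> local_ring" "x = upow (val x) \<otimes> e" "ac x = res e"
    by (rule val_ac_decomp[OF assms(1)])
  obtain f where f: "f \<in> local_units" "f \<in> local_ring" "y = upow (val y) \<otimes> f" "ac y = res f"
    by (rule val_ac_decomp[OF assms(2)])
  obtain g where g: "g \<in> local_ring" "x \<oplus> y = upow (val x) \<otimes> g" "res g = res e \<oplus>\<^bsub>F\<^esub> res f"
    using upow_add_decomp[OF _ e(2) f(2), of "val x" "val x"] e(3) f(3) assms(3) by (metis order_refl)
  have gu: "g \<in> local_units" using g e f assms(4) local_units_iff by simp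
  have "x \<oplus> y \<noteq> \<zero> \<and> val (x \<oplus> y) = val x \<and> ac (x \<oplus> y) = ac x \<oplus>\<^bsub>F\<^esub> ac y"
    using val_ac_eqI[OF gu g(2)] g(3) e(4) f(4) by simp
  then show "x \<oplus> y \<noteq> \<zero>" "val (x \<oplus> y) = val x" "ac (x \<oplus> y) = ac x \<oplus>\<^bsub>F\<^esub> ac y" by auto
qed

lemma val_add_ge:
  assumes "x \<in> carrier K - {\<zero>}" "y \<in> carrier K - {\<zero>}" "x \<oplus> y \<noteq> \<zero>" "N \<le> val x" "N \<le> val y"
  shows "N \<le> val (x \<oplus> y)"
proof -
  have main: "N \<le> val (x \<oplus> y)"
    if a: "x \<in> carrier K - {\<zero>}" "y \<in> carrier K - {\<zero>}" "x \<oplus> y \<noteq> \<zero>" "N \<le> val x" "val x \<le> val y" for x y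
  proof -
    obtain e where e: "e \<in> local_units" "e \<in> local_ring" "x = upow (val x) \<otimes> e" "ac x = res e"
      by (rule val_ac_decomp[OF a(1)])
    obtain f where f: "f \<in> local_units" "f \<in> local_ring" "y = upow (val y) \<otimes> f" "ac y = res f"
      by (rule val_ac_decomp[OF a(2)])
    obtain g where g: "g \<in> local_ring" "x \<oplus> y = upow (val x) \<otimes> g"
      using upow_add_decomp[OF a(5) e(2) f(2)] e(3) f(3) by metis
    have gK: "g \<in> carrier K" using local_ring_carrier g by blast
    have "g \<noteq> \<zero>" using g a(3) upow_carrier by auto
    then have "val g \<ge> 0" "g \<in> carrier K - {\<zero>}" using local_ring_val g gK by auto
    moreover have "val (upow (val x)) = val x"
    proof -
      have "\<one> \<in> local_units" using local_unitsI[OF units_notin_p_closed(1) units_notin_p_closed(1)] by simp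
      then show ?thesis using val_eqI[of \<one> "val x"] upow_carrier by simp
    qed
    ultimately have "val (x \<oplus> y) = val x + val g"
      using val_ac_mult(1)[of "upow (val x)" g] upow_carrier g(2) by simp
    then show ?thesis using a(4) \<open>val g \<ge> 0\<close> by simp
  qed
  show ?thesis
  proof (cases "val x \<le> val y")
    case True then show ?thesis using main assms by blast
  next
    case False
    then have "N \<le> val (y \<oplus> x)" using assms by (intro main) (auto simp: a_comm)
    then show ?thesis using assms by (simp add: a_comm)
  qed
qed

section \<open>The completion\<close>

text \<open>The fractional ideal of elements of valuation at least \<open>N\<close>.  Zero is put in explicitly, because its
  valuation is a default value without meaning.\<close>

definition padic_ball :: "int \<Rightarrow> 'a set" where
  "padic_ball N = {x \<in> carrier K. x = \<zero> \<or> N \<le> val x}"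

lemma padic_ball_carrier: "x \<in> padic_ball N \<Longrightarrow> x \<in> carrier K"
  by (simp add: padic_ball_def)

lemma padic_ball_add: "\<lbrakk>x \<in> padic_ball N; y \<in> padic_ball N\<rbrakk> \<Longrightarrow> x \<oplus> y \<in> padic_ball N"
  using val_add_ge[of x y N] unfolding padic_ball_def by (cases "x = \<zero>"; cases "y = \<zero>") auto

lemma padic_ball_mult: "\<lbrakk>x \<in> padic_ball M; y \<in> padic_ball N\<rbrakk> \<Longrightarrow> x \<otimes> y \<in> padic_ball (M + N)"
  using val_ac_mult(1)[of x y] unfolding padic_ball_def by (cases "x = \<zero>"; cases "y = \<zero>") auto

lemma padic_ball_mono: "M \<le> N \<Longrightarrow> padic_ball N \<subseteq> padic_ball M"
  unfolding padic_ball_def by auto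

lemma minus_one_unit: "\<ominus> \<one> \<in> R - p"
proof -
  have "\<one> = (\<ominus> \<one>) \<otimes> (\<ominus> \<one>)" by (simp add: l_minus)
  then show ?thesis using one_notin_p p_closed(3)[of "\<ominus> \<one>" "\<ominus> \<one>"] R_closed(2,3) by auto
qed

lemma padic_ball_neg: "x \<in> padic_ball N \<Longrightarrow> \<ominus> x \<in> padic_ball N"
proof -
  assume x: "x \<in> padic_ball N"
  have "\<ominus> \<one> \<in> padic_ball 0" using val_ac_unit(1)[OF minus_one_unit] by (simp add: padic_ball_def)
  then have "(\<ominus> \<one>) \<otimes> x \<in> padic_ball (0 + N)" using x by (rule padic_ball_mult)
  moreover have "(\<ominus> \<one>) \<otimes> x = \<ominus> x" using padic_ball_carrier[OF x] by (simp add: l_minus)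
  ultimately show ?thesis by simp
qed

lemma padic_close_iff:
  assumes "x \<in> carrier K" "y \<in> carrier K"
  shows "padic_close K R p N x y \<longleftrightarrow> x \<ominus> y \<in> padic_ball N"
  using assms by (simp add: padic_close_def padic_ball_def)

lemma padic_cauchy_iff:
  "padic_cauchy K R p s \<longleftrightarrow>
     (\<forall>i. s i \<in> carrier K) \<and> (\<forall>N. \<exists>M. \<forall>i\<ge>M. \<forall>j\<ge>M. s i \<ominus> s j \<in> padic_ball N)"
  unfolding padic_cauchy_def by (auto simp: padic_close_iff)

lemma padic_null_iff:
  "padic_null K R p s \<longleftrightarrow> (\<forall>i. s i \<in> carrier K) \<and> (\<forall>N. \<forall>\<^sub>F i in sequentially. s i \<in> padic_ball N)"
  unfolding padic_null_def eventually_sequentially by (auto simp: padic_close_iff a_minus_def)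

lemma padic_nullD: "padic_null K R p s \<Longrightarrow> \<forall>\<^sub>F i in sequentially. s i \<in> padic_ball N"
  unfolding padic_null_iff by blast

lemma padic_cauchy_carrier: "padic_cauchy K R p s \<Longrightarrow> s i \<in> carrier K"
  unfolding padic_cauchy_def by blast

lemma padic_null_carrier: "padic_null K R p s \<Longrightarrow> s i \<in> carrier K"
  unfolding padic_null_def by blast

lemma padic_cauchyD:
  assumes "padic_cauchy K R p s"
  obtains M where "\<And>i j. \<lbrakk>i \<ge> M; j \<ge> M\<rbrakk> \<Longrightarrow> s i \<ominus> s j \<in> padic_ball N"
  using assms unfolding padic_cauchy_iff by meson

lemma padic_cauchyI:
  assumes "\<And>i. s i \<in> carrier K" "\<And>N. \<exists>M. \<forall>i\<ge>M. \<forall>j\<ge>M. s i \<ominus> s j \<in> padic_ball N"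
  shows "padic_cauchy K R p s"
  using assms unfolding padic_cauchy_iff by blast

lemma in_some_padic_ball: "x \<in> carrier K \<Longrightarrow> \<exists>N. x \<in> padic_ball N"
  unfolding padic_ball_def by auto

lemma padic_cauchy_bounded:
  assumes "padic_cauchy K R p s"
  obtains B M where "\<And>i. i \<ge> M \<Longrightarrow> s i \<in> padic_ball B"
proof -
  obtain M where M: "\<And>i j. \<lbrakk>i \<ge> M; j \<ge> M\<rbrakk> \<Longrightarrow> s i \<ominus> s j \<in> padic_ball 0"
    using padic_cauchyD[OF assms, of 0] by blast
  obtain N where N: "s M \<in> padic_ball N" using in_some_padic_ball padic_cauchy_carrier[OF assms] by blast
  have "s i \<in> padic_ball (min 0 N)" if "i \<ge> M" for i
  proof -
    have "(s i \<ominus> s M) \<oplus> s M \<in> padic_ball (min 0 N)"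
      using M[OF that order_refl] N padic_ball_mono[of "min 0 N" 0] padic_ball_mono[of "min 0 N" N]
        by (intro padic_ball_add) auto
    moreover have "(s i \<ominus> s M) \<oplus> s M = s i"
      using padic_cauchy_carrier[OF assms] by (simp add: a_minus_def a_assoc l_neg)
    ultimately show ?thesis by simp
  qed
  then show ?thesis using that by blast
qed

lemma padic_cauchy_const: "x \<in> carrier K \<Longrightarrow> padic_cauchy K R p (\<lambda>i. x)"
  by (rule padic_cauchyI) (simp_all add: padic_ball_def)

lemma padic_cauchy_add:
  assumes s: "padic_cauchy K R p s" and t: "padic_cauchy K R p t"
  shows "padic_cauchy K R p (\<lambda>i. s i \<oplus> t i)"
proof (rule padic_cauchyI)
  fix N
  note c = padic_cauchy_carrier[OF s] padic_cauchy_carrier[OF t]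
  obtain M1 where M1: "\<And>i j. \<lbrakk>i \<ge> M1; j \<ge> M1\<rbrakk> \<Longrightarrow> s i \<ominus> s j \<in> padic_ball N"
    using padic_cauchyD[OF s, of N] by blast
  obtain M2 where M2: "\<And>i j. \<lbrakk>i \<ge> M2; j \<ge> M2\<rbrakk> \<Longrightarrow> t i \<ominus> t j \<in> padic_ball N"
    using padic_cauchyD[OF t, of N] by blast
  have "(s i \<oplus> t i) \<ominus> (s j \<oplus> t j) \<in> padic_ball N" if "i \<ge> max M1 M2" "j \<ge> max M1 M2" for i j
  proof -
    have "(s i \<oplus> t i) \<ominus> (s j \<oplus> t j) = (s i \<ominus> s j) \<oplus> (t i \<ominus> t j)"
      using c by (simp add: a_minus_def minus_add a_ac)
    then show ?thesis using padic_ball_add[OF M1[of i j] M2[of i j]] that by simp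
  qed
  then show "\<exists>M. \<forall>i\<ge>M. \<forall>j\<ge>M. (s i \<oplus> t i) \<ominus> (s j \<oplus> t j) \<in> padic_ball N" by blast
qed (use padic_cauchy_carrier[OF s] padic_cauchy_carrier[OF t] in simp)

lemma padic_cauchy_mult:
  assumes s: "padic_cauchy K R p s" and t: "padic_cauchy K R p t"
  shows "padic_cauchy K R p (\<lambda>i. s i \<otimes> t i)"
proof (rule padic_cauchyI)
  fix N
  note c = padic_cauchy_carrier[OF s] padic_cauchy_carrier[OF t]
  obtain B M1 where B: "\<And>i. i \<ge> M1 \<Longrightarrow> s i \<in> padic_ball B" using padic_cauchy_bounded[OF s] by blast
  obtain B' M2 where B': "\<And>i. i \<ge> M2 \<Longrightarrow> t i \<in> padic_ball B'" using padic_cauchy_bounded[OF t] by blast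
  obtain M3 where M3: "\<And>i j. \<lbrakk>i \<ge> M3; j \<ge> M3\<rbrakk> \<Longrightarrow> s i \<ominus> s j \<in> padic_ball (N - B')"
    using padic_cauchyD[OF s, of "N - B'"] by blast
  obtain M4 where M4: "\<And>i j. \<lbrakk>i \<ge> M4; j \<ge> M4\<rbrakk> \<Longrightarrow> t i \<ominus> t j \<in> padic_ball (N - B)"
    using padic_cauchyD[OF t, of "N - B"] by blast
  define M where "M = max (max M1 M2) (max M3 M4)"
  have "(s i \<otimes> t i) \<ominus> (s j \<otimes> t j) \<in> padic_ball N" if "i \<ge> M" "j \<ge> M" for i j
  proof -
    have "(s i \<otimes> t i) \<ominus> (s j \<otimes> t j) = s i \<otimes> (t i \<ominus> t j) \<oplus> (s i \<ominus> s j) \<otimes> t j"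
    proof -
      have "s i \<otimes> (t i \<ominus> t j) \<oplus> (s i \<ominus> s j) \<otimes> t j
          = s i \<otimes> t i \<oplus> (\<ominus> (s i \<otimes> t j) \<oplus> (s i \<otimes> t j \<oplus> \<ominus> (s j \<otimes> t j)))"
        using c by (simp add: a_minus_def l_distr r_distr l_minus r_minus a_assoc)
      also have "\<dots> = s i \<otimes> t i \<ominus> s j \<otimes> t j" using c by (simp add: a_minus_def r_neg1)
      finally show ?thesis by simp
    qed
    moreover have "s i \<otimes> (t i \<ominus> t j) \<in> padic_ball (B + (N - B))"
      using that B M4 by (intro padic_ball_mult) (auto simp: M_def)
    moreover have "(s i \<ominus> s j) \<otimes> t j \<in> padic_ball ((N - B') + B')"
      using that B' M3 by (intro padic_ball_mult) (auto simp: M_def)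
    ultimately show ?thesis using padic_ball_add by simp
  qed
  then show "\<exists>M. \<forall>i\<ge>M. \<forall>j\<ge>M. (s i \<otimes> t i) \<ominus> (s j \<otimes> t j) \<in> padic_ball N" by blast
qed (use padic_cauchy_carrier[OF s] padic_cauchy_carrier[OF t] in simp)

lemma padic_null_imp_cauchy:
  assumes "padic_null K R p s" shows "padic_cauchy K R p s"
proof (rule padic_cauchyI)
  fix N
  obtain M where M: "\<And>i. i \<ge> M \<Longrightarrow> s i \<in> padic_ball N"
    using padic_nullD[OF assms, of N] unfolding eventually_sequentially by blast
  then have "s i \<ominus> s j \<in> padic_ball N" if "i \<ge> M" "j \<ge> M" for i j
    using that padic_ball_add padic_ball_neg unfolding a_minus_def by blast
  then show "\<exists>M. \<forall>i\<ge>M. \<forall>j\<ge>M. s i \<ominus> s j \<in> padic_ball N" by blast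
qed (use padic_null_carrier[OF assms] in simp)

lemma padic_null_zero: "padic_null K R p (\<lambda>i. \<zero>)"
  by (simp add: padic_null_iff padic_ball_def)

lemma padic_null_add:
  assumes "padic_null K R p s" "padic_null K R p t"
  shows "padic_null K R p (\<lambda>i. s i \<oplus> t i)"
  unfolding padic_null_iff
proof (intro conjI allI)
  show "\<forall>\<^sub>F i in sequentially. s i \<oplus> t i \<in> padic_ball N" for N
    using padic_nullD[OF assms(1), of N] padic_nullD[OF assms(2), of N]
    by eventually_elim (rule padic_ball_add)
qed (use padic_null_carrier[OF assms(1)] padic_null_carrier[OF assms(2)] in simp)

lemma padic_null_mult:
  assumes s: "padic_cauchy K R p s" and t: "padic_null K R p t"
  shows "padic_null K R p (\<lambda>i. s i \<otimes> t i)"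
  unfolding padic_null_iff
proof (intro conjI allI)
  fix N
  obtain B M1 where B: "\<And>i. i \<ge> M1 \<Longrightarrow> s i \<in> padic_ball B" using padic_cauchy_bounded[OF s] by blast
  then have "\<forall>\<^sub>F i in sequentially. s i \<in> padic_ball B" unfolding eventually_sequentially by blast
  then show "\<forall>\<^sub>F i in sequentially. s i \<otimes> t i \<in> padic_ball N"
    using padic_nullD[OF t, of "N - B"]
  proof eventually_elim
    case (elim i)
    then show ?case using padic_ball_mult[of "s i" B "t i" "N - B"] by simp
  qed
qed (use padic_cauchy_carrier[OF s] padic_null_carrier[OF t] in simp)

abbreviation C where "C \<equiv> cauchy_ring K R p"
abbreviation null_ideal where "null_ideal \<equiv> {s. padic_null K R p s}"

lemma cauchy_ring_simps:
  "carrier C = {s. padic_cauchy K R p s}" "s \<otimes>\<^bsub>C\<^esub> t = (\<lambda>i. s i \<otimes> t i)" "s \<oplus>\<^bsub>C\<^esub> t = (\<lambda>i. s i \<oplus> t i)"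
  "\<one>\<^bsub>C\<^esub> = (\<lambda>i. \<one>)" "\<zero>\<^bsub>C\<^esub> = (\<lambda>i. \<zero>)"
  by (simp_all add: cauchy_ring_def)

lemma padic_cauchy_neg:
  assumes "padic_cauchy K R p s" shows "padic_cauchy K R p (\<lambda>i. \<ominus> s i)"
proof -
  have "(\<lambda>i. (\<ominus> \<one>) \<otimes> s i) = (\<lambda>i. \<ominus> s i)" using padic_cauchy_carrier[OF assms] by (simp add: l_minus)
  then show ?thesis using padic_cauchy_mult[OF padic_cauchy_const[of "\<ominus> \<one>"] assms] by simp
qed

lemma cauchy_ring_cring: "cring C"
proof (rule cringI)
  show "abelian_group C"
  proof (rule abelian_groupI)
    show "\<exists>t\<in>carrier C. t \<oplus>\<^bsub>C\<^esub> s = \<zero>\<^bsub>C\<^esub>" if "s \<in> carrier C" for s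
      using that padic_cauchy_neg padic_cauchy_carrier
      by (intro bexI[of _ "\<lambda>i. \<ominus> s i"]) (auto simp: cauchy_ring_simps l_neg)
  qed (auto simp: cauchy_ring_simps padic_cauchy_add padic_cauchy_const a_ac padic_cauchy_carrier)
  show "comm_monoid C"
    by (rule comm_monoidI) (auto simp: cauchy_ring_simps padic_cauchy_mult padic_cauchy_const m_ac
      padic_cauchy_carrier)
qed (auto simp: cauchy_ring_simps l_distr padic_cauchy_carrier)

sublocale C: cring C by (rule cauchy_ring_cring)

lemma cauchy_ring_neg:
  assumes "padic_cauchy K R p s" shows "\<ominus>\<^bsub>C\<^esub> s = (\<lambda>i. \<ominus> s i)"
  using assms padic_cauchy_neg padic_cauchy_carrier
  by (intro C.minus_equality) (auto simp: cauchy_ring_simps l_neg)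

lemma null_ideal: "ideal null_ideal C"
proof (rule idealI)
  have neg: "(\<lambda>i. \<ominus> s i) \<in> null_ideal" if "s \<in> null_ideal" for s
  proof -
    have eq: "(\<lambda>i. (\<ominus> \<one>) \<otimes> s i) = (\<lambda>i. \<ominus> s i)" using padic_null_carrier that by (simp add: l_minus)
    have "padic_null K R p (\<lambda>i. (\<ominus> \<one>) \<otimes> s i)"
      using that by (intro padic_null_mult padic_cauchy_const) auto
    then show ?thesis unfolding eq by simp
  qed
  show "subgroup null_ideal (add_monoid C)"
  proof (rule subgroup.intro)
    show "inv\<^bsub>add_monoid C\<^esub> s \<in> null_ideal" if "s \<in> null_ideal" for s
      using neg[OF that] cauchy_ring_neg[of s] padic_null_imp_cauchy[of s] that by (simp add: a_inv_def)
  qed (auto simp: cauchy_ring_simps padic_null_imp_cauchy padic_null_add padic_null_zero)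
  show "s \<otimes>\<^bsub>C\<^esub> t \<in> null_ideal" "t \<otimes>\<^bsub>C\<^esub> s \<in> null_ideal" if "t \<in> null_ideal" "s \<in> carrier C" for s t
  proof -
    show 1: "s \<otimes>\<^bsub>C\<^esub> t \<in> null_ideal" using that padic_null_mult by (simp add: cauchy_ring_simps)
    have "t \<otimes>\<^bsub>C\<^esub> s = s \<otimes>\<^bsub>C\<^esub> t"
      using that padic_null_imp_cauchy by (intro C.m_comm) (auto simp: cauchy_ring_simps)
    then show "t \<otimes>\<^bsub>C\<^esub> s \<in> null_ideal" using 1 by simp
  qed
qed (rule C.ring_axioms)

abbreviation L where "L \<equiv> completion K R p"
abbreviation lim :: "(nat \<Rightarrow> 'a) \<Rightarrow> (nat \<Rightarrow> 'a) set" where "lim s \<equiv> null_ideal +>\<^bsub>C\<^esub> s"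

lemma lim_hom: "ring_hom_cring C L lim"
  unfolding completion_def by (rule ideal.rcos_ring_hom_cring[OF null_ideal C.cring_axioms])

sublocale lim: ring_hom_cring C L lim by (rule lim_hom)

lemma completionE:
  assumes "\<xi> \<in> carrier L"
  obtains s where "padic_cauchy K R p s" "\<xi> = lim s"
  using assms unfolding completion_def FactRing_def A_RCOSETS_def' by (auto simp: cauchy_ring_simps)

lemma lim_eq_iff:
  assumes "padic_cauchy K R p s" "padic_cauchy K R p t"
  shows "lim s = lim t \<longleftrightarrow> padic_null K R p (\<lambda>i. s i \<ominus> t i)"
  using C.quotient_eq_iff_same_a_r_cos[OF null_ideal, of s t] assms cauchy_ring_neg[of t]
  by (simp add: cauchy_ring_simps C.minus_eq a_minus_def)

text \<open>A Cauchy sequence that is not null has, beyond the index where its terms are close to each other, a term of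
  valuation below that closeness.  All later terms differ from this one by
  something of larger valuation, hence share its valuation and its angular component.\<close>

lemma padic_cauchy_not_null:
  assumes s: "padic_cauchy K R p s" and nn: "\<not> padic_null K R p s"
  obtains m r where "r \<in> carrier F - {\<zero>\<^bsub>F\<^esub>}"
    "\<forall>\<^sub>F i in sequentially. s i \<in> carrier K - {\<zero>} \<and> val (s i) = m \<and> ac (s i) = r"
proof -
  note c = padic_cauchy_carrier[OF s]
  obtain N where N: "\<not> (\<forall>\<^sub>F i in sequentially. s i \<in> padic_ball N)"
    using nn c unfolding padic_null_iff by blast
  obtain M where M: "\<And>i j. \<lbrakk>i \<ge> M; j \<ge> M\<rbrakk> \<Longrightarrow> s i \<ominus> s j \<in> padic_ball N"
    using padic_cauchyD[OF s, of N] by blast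
  obtain k where k: "k \<ge> M" "s k \<notin> padic_ball N" using N unfolding eventually_sequentially by blast
  have sk: "s k \<in> carrier K - {\<zero>}" "val (s k) < N" using k(2) c unfolding padic_ball_def by auto
  have "s i \<in> carrier K - {\<zero>} \<and> val (s i) = val (s k) \<and> ac (s i) = ac (s k)" if "i \<ge> M" for i
  proof -
    have "s i \<ominus> s k \<in> padic_ball N" using M k that by blast
    then have "s i \<ominus> s k = \<zero> \<or> val (s k) < val (s i \<ominus> s k)" using sk unfolding padic_ball_def by auto
    moreover have "s k \<oplus> (s i \<ominus> s k) = s i"
      using c by (metis a_comm a_minus_def add.inv_solve_right add.m_closed minus_closed)
    ultimately show ?thesis using val_ac_add_less[OF sk(1), of "s i \<ominus> s k"] c by simp
  qed
  then show ?thesis using that[of "ac (s k)" "val (s k)"] ac_nonzero[OF sk(1)]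
    unfolding eventually_sequentially by blast
qed

section \<open>The colouring\<close>

text \<open>A Cauchy sequence with the given limit whose valuation and angular component have become constant.\<close>

definition represents :: "(nat \<Rightarrow> 'a) \<Rightarrow> (nat \<Rightarrow> 'a) set \<Rightarrow> int \<Rightarrow> 'a set \<Rightarrow> bool" where
  "represents s \<xi> m r \<longleftrightarrow> padic_cauchy K R p s \<and> \<xi> = lim s \<and> r \<in> carrier F - {\<zero>\<^bsub>F\<^esub>} \<and>
     (\<forall>\<^sub>F i in sequentially. s i \<in> carrier K - {\<zero>} \<and> val (s i) = m \<and> ac (s i) = r)"

text \<open>The angular component of an element of the completion, read off from some sequence that represents it.
  Any one sequence serves the argument below, so independence of this choice need not be established.\<close>

definition colour :: "(nat \<Rightarrow> 'a) set \<Rightarrow> 'a set" where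
  "colour \<xi> = (SOME r. \<exists>s m. represents s \<xi> m r)"

lemma colour_represented:
  assumes "\<xi> \<in> carrier L - {\<zero>\<^bsub>L\<^esub>}"
  shows "\<exists>s m. represents s \<xi> m (colour \<xi>)"
proof -
  obtain s where s: "padic_cauchy K R p s" "\<xi> = lim s" using assms by (auto elim: completionE)
  have "\<not> padic_null K R p s"
  proof
    assume "padic_null K R p s"
    then have "lim s = lim \<zero>\<^bsub>C\<^esub>"
      using lim_eq_iff[OF s(1), of "\<lambda>i. \<zero>"] padic_cauchy_const[of \<zero>] padic_cauchy_carrier[OF s(1)]
      by (simp add: cauchy_ring_simps a_minus_def)
    then show False using assms s(2) by simp
  qed
  then obtain m r where "r \<in> carrier F - {\<zero>\<^bsub>F\<^esub>}"
    "\<forall>\<^sub>F i in sequentially. s i \<in> carrier K - {\<zero>} \<and> val (s i) = m \<and> ac (s i) = r"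
    using padic_cauchy_not_null[OF s(1)] by blast
  then have "represents s \<xi> m r" using s unfolding represents_def by blast
  then have "\<exists>r s m. represents s \<xi> m r" by blast
  then show ?thesis unfolding colour_def by (rule someI_ex)
qed

text \<open>The heart of the proof, for elements of \<open>K\<close> and an equation holding up to a small error.  The leading
  coefficient of \<open>a x + b y\<close> is \<open>a r\<close> or \<open>b r\<close> if one valuation is smaller and \<open>(a + b) r\<close>
  if they agree; none of these vanishes modulo \<open>p\<close>.  An error of larger valuation does not change
  it, so it equals the leading coefficient \<open>c r r^n\<close> of \<open>c w z^n\<close>, and \<open>r\<close> cancels.\<close>

lemma equation_residue:
  assumes abc: "a \<in> R - p" "b \<in> R - p" "c \<in> R - p" "a \<oplus> b \<in> R - p"
    and nz: "x \<in> carrier K - {\<zero>}" "y \<in> carrier K - {\<zero>}" "w \<in> carrier K - {\<zero>}" "z \<in> carrier K - {\<zero>}"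
    and r: "ac x = r" "ac y = r" "ac w = r" "ac z = r"
    and e: "(a \<otimes> x \<oplus> b \<otimes> y) \<ominus> c \<otimes> w \<otimes> z [^] (n::nat) \<in> padic_ball N" and N: "min (val x) (val y) < N"
  shows "\<exists>v\<in>coeff_ratios K a b c. res v = r [^]\<^bsub>F\<^esub> n"
proof -
  have rF: "r \<in> carrier F" "r \<noteq> \<zero>\<^bsub>F\<^esub>" using ac_nonzero[OF nz(1)] r(1) by auto
  have k: "a \<in> carrier K - {\<zero>}" "b \<in> carrier K - {\<zero>}" "c \<in> carrier K - {\<zero>}"
    using abc notin_p_nonzero by auto
  have ax: "a \<otimes> x \<in> carrier K - {\<zero>}" "val (a \<otimes> x) = val x" "ac (a \<otimes> x) = coset a \<otimes>\<^bsub>F\<^esub> r"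
    using nonzero_m_closed[OF k(1) nz(1)] val_ac_mult[OF k(1) nz(1)] val_ac_unit[OF abc(1)] r by auto
  have b_y: "b \<otimes> y \<in> carrier K - {\<zero>}" "val (b \<otimes> y) = val y" "ac (b \<otimes> y) = coset b \<otimes>\<^bsub>F\<^esub> r"
    using nonzero_m_closed[OF k(2) nz(2)] val_ac_mult[OF k(2) nz(2)] val_ac_unit[OF abc(2)] r by auto
  have ab: "coset (a \<oplus> b) = coset a \<oplus>\<^bsub>F\<^esub> coset b" using abc coset_simps(3) by simp
  define S where "S = a \<otimes> x \<oplus> b \<otimes> y"
  have SK: "S \<in> carrier K" using ax b_y by (simp add: S_def)
  \<comment> \<open>\<open>u\<close> is the coefficient that dominates: which one it is depends on the comparison of valuations.\<close>
  have "\<exists>u\<in>{a, b, a \<oplus> b}. S \<noteq> \<zero> \<and> val S = min (val x) (val y) \<and> ac S = coset u \<otimes>\<^bsub>F\<^esub> r"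
  proof (cases "val x" "val y" rule: linorder_cases)
    case less
    then show ?thesis using val_ac_add_less[OF ax(1), of "b \<otimes> y"] ax b_y by (auto simp: S_def)
  next
    case greater
    have "S = b \<otimes> y \<oplus> a \<otimes> x" using ax b_y by (simp add: S_def a_comm)
    then show ?thesis using greater val_ac_add_less[OF b_y(1), of "a \<otimes> x"] ax b_y by auto
  next
    case equal
    have cF: "coset a \<in> carrier F" "coset b \<in> carrier F" using coset_simps(1) abc by auto
    have s: "coset a \<otimes>\<^bsub>F\<^esub> r \<oplus>\<^bsub>F\<^esub> coset b \<otimes>\<^bsub>F\<^esub> r = coset (a \<oplus> b) \<otimes>\<^bsub>F\<^esub> r"
      unfolding ab using cF rF by (simp add: F.l_distr)
    have "coset (a \<oplus> b) \<otimes>\<^bsub>F\<^esub> r \<noteq> \<zero>\<^bsub>F\<^esub>" using coset_nonzero[OF abc(4)] rF F.integral by blast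
    then have "S \<noteq> \<zero> \<and> val S = val x \<and> ac S = coset (a \<oplus> b) \<otimes>\<^bsub>F\<^esub> r"
      using val_ac_add_equal[OF ax(1) b_y(1)] equal ax b_y s by (simp add: S_def)
    then show ?thesis using equal by auto
  qed
  then obtain u where u: "u \<in> {a, b, a \<oplus> b}" "S \<noteq> \<zero>" "val S = min (val x) (val y)" "ac S = coset u \<otimes>\<^bsub>F\<^esub> r"
    by blast
  have uR: "u \<in> R - p" using u(1) abc by auto
  define T where "T = c \<otimes> w \<otimes> z [^] n"
  have cw: "c \<otimes> w \<in> carrier K - {\<zero>}" using nonzero_m_closed k nz by blast
  have zn: "z [^] n \<in> carrier K - {\<zero>}" using nonzero_pow_closed nz by blast
  have T: "T \<in> carrier K" "ac T = coset c \<otimes>\<^bsub>F\<^esub> r \<otimes>\<^bsub>F\<^esub> r [^]\<^bsub>F\<^esub> n"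
    using cw zn val_ac_mult(2)[OF cw zn] val_ac_mult(2)[OF k(3) nz(3)] val_ac_unit(2)[OF abc(3)]
      val_ac_pow[OF nz(4)] r
    unfolding T_def by auto
  have "\<ominus> (S \<ominus> T) \<in> padic_ball N" using e padic_ball_neg unfolding S_def T_def by blast
  then have "\<ominus> (S \<ominus> T) = \<zero> \<or> val S < val (\<ominus> (S \<ominus> T))" using N u(3) unfolding padic_ball_def by auto
  moreover have "T = S \<oplus> (\<ominus> (S \<ominus> T))"
    using SK T by (simp add: a_minus_def minus_add r_neg1 r_neg2 a_assoc[symmetric] r_neg)
  ultimately have "ac T = ac S" using val_ac_add_less(3)[of S "\<ominus> (S \<ominus> T)"] SK T u(2) by simp
  then have eq: "coset c \<otimes>\<^bsub>F\<^esub> r \<otimes>\<^bsub>F\<^esub> r [^]\<^bsub>F\<^esub> n = coset u \<otimes>\<^bsub>F\<^esub> r" using T u by simp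
  have cF: "coset c \<in> carrier F - {\<zero>\<^bsub>F\<^esub>}" "coset u \<in> carrier F" using coset_nonzero abc uR by auto
  have rn: "r [^]\<^bsub>F\<^esub> n \<in> carrier F" using rF by simp
  have "(r [^]\<^bsub>F\<^esub> n \<otimes>\<^bsub>F\<^esub> coset c) \<otimes>\<^bsub>F\<^esub> r = coset u \<otimes>\<^bsub>F\<^esub> r" using eq cF rn rF by (simp add: F.m_ac)
  then have "r [^]\<^bsub>F\<^esub> n \<otimes>\<^bsub>F\<^esub> coset c = coset u" using F.m_rcancel[of r] cF rn rF by simp
  then have "r [^]\<^bsub>F\<^esub> n = coset u \<otimes>\<^bsub>F\<^esub> inv\<^bsub>F\<^esub> coset c" using F.eq_fraction_iff[OF rn cF(2,1)] by simp
  then have "res (u \<otimes> inv c) = r [^]\<^bsub>F\<^esub> n" using res_fraction[of u c] uR abc by simp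
  moreover have "u \<otimes> inv c \<in> coeff_ratios K a b c" using u(1) by (auto simp: coeff_ratios_def)
  ultimately show ?thesis by blast
qed

lemma cauchy_ring_pow: "s [^]\<^bsub>C\<^esub> (n::nat) = (\<lambda>i. s i [^] n)"
  by (induction n) (simp_all add: cauchy_ring_simps)

text \<open>An equation between limits says that the two sides form sequences with null difference.  At a late
  index the difference has valuation above that of \<open>a x + b y\<close>, which is the situation of the previous lemma.\<close>

lemma monochromatic_residue:
  assumes abc: "a \<in> R - p" "b \<in> R - p" "c \<in> R - p" "a \<oplus> b \<in> R - p"
    and reps: "represents x \<xi> mx r" "represents y \<eta> my r" "represents w \<omega> mw r" "represents z \<zeta> mz r"
    and eq: "completion_embed K R p a \<otimes>\<^bsub>L\<^esub> \<xi> \<oplus>\<^bsub>L\<^esub> completion_embed K R p b \<otimes>\<^bsub>L\<^esub> \<eta>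
       = completion_embed K R p c \<otimes>\<^bsub>L\<^esub> \<omega> \<otimes>\<^bsub>L\<^esub> \<zeta> [^]\<^bsub>L\<^esub> (n::nat)"
  shows "\<exists>v\<in>coeff_ratios K a b c. res v = r [^]\<^bsub>F\<^esub> n"
proof -
  have k: "a \<in> carrier K" "b \<in> carrier K" "c \<in> carrier K" using abc R_carrier by auto
  have cs: "padic_cauchy K R p x" "padic_cauchy K R p y" "padic_cauchy K R p w" "padic_cauchy K R p z"
    and lims: "\<xi> = lim x" "\<eta> = lim y" "\<omega> = lim w" "\<zeta> = lim z"
    using reps unfolding represents_def by auto
  have CC: "x \<in> carrier C" "y \<in> carrier C" "w \<in> carrier C" "z \<in> carrier C"
    "(\<lambda>i. a) \<in> carrier C" "(\<lambda>i. b) \<in> carrier C" "(\<lambda>i. c) \<in> carrier C"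
    using cs k padic_cauchy_const by (simp_all add: cauchy_ring_simps)
  define S where "S = (\<lambda>i. a) \<otimes>\<^bsub>C\<^esub> x \<oplus>\<^bsub>C\<^esub> (\<lambda>i. b) \<otimes>\<^bsub>C\<^esub> y"
  define T where "T = (\<lambda>i. c) \<otimes>\<^bsub>C\<^esub> w \<otimes>\<^bsub>C\<^esub> z [^]\<^bsub>C\<^esub> n"
  have "S \<in> carrier C" "T \<in> carrier C" using CC unfolding S_def T_def by simp_all
  moreover have "lim S = lim T" using eq CC unfolding S_def T_def lims completion_embed_def by simp
  ultimately have null: "padic_null K R p (\<lambda>i. S i \<ominus> T i)" using lim_eq_iff by (simp add: cauchy_ring_simps)
  \<comment> \<open>Any precision beyond the valuation \<open>min mx my\<close> of the left-hand side is enough.\<close>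
  define N where "N = min mx my + 1"
  have "\<forall>\<^sub>F i in sequentially. S i \<ominus> T i \<in> padic_ball N" by (rule padic_nullD[OF null])
  moreover have "\<forall>\<^sub>F i in sequentially. x i \<in> carrier K - {\<zero>} \<and> val (x i) = mx \<and> ac (x i) = r"
    "\<forall>\<^sub>F i in sequentially. y i \<in> carrier K - {\<zero>} \<and> val (y i) = my \<and> ac (y i) = r"
    "\<forall>\<^sub>F i in sequentially. w i \<in> carrier K - {\<zero>} \<and> val (w i) = mw \<and> ac (w i) = r"
    "\<forall>\<^sub>F i in sequentially. z i \<in> carrier K - {\<zero>} \<and> val (z i) = mz \<and> ac (z i) = r"
    using reps unfolding represents_def by blast+
  ultimately have "\<forall>\<^sub>F i in sequentially. \<exists>v\<in>coeff_ratios K a b c. res v = r [^]\<^bsub>F\<^esub> n"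
  proof eventually_elim
    case (elim i)
    have "(a \<otimes> x i \<oplus> b \<otimes> y i) \<ominus> c \<otimes> w i \<otimes> z i [^] n \<in> padic_ball N"
      using elim(1) unfolding S_def T_def by (simp add: cauchy_ring_simps cauchy_ring_pow)
    then show ?case using elim abc
      by (intro equation_residue[of a b c "x i" "y i" "w i" "z i" r n N]) (auto simp: N_def)
  qed
  then show ?thesis by simp
qed

lemma nth_power_mod_one: "nth_power_mod K R p n \<one>"
  unfolding nth_power_mod_def using R_local_ring(2)[OF R_closed(2)] coset_simps(4)
  by (intro bexI[of _ "\<one>\<^bsub>F\<^esub>"]) auto

end

section \<open>The colouring is free of monochromatic solutions\<close>

theorem theorem17:
  fixes K :: "('a, 'm) ring_scheme" (structure)
    and R p :: "'a set" and k n :: nat and a b c :: "nat \<Rightarrow> 'a"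
  defines "L \<equiv> completion K R p"
    and "\<iota> \<equiv> completion_embed K R p"
    and "I \<equiv> (\<Inter>i\<in>{1..k}. coeff_ratios K (a i) (b i) (c i))"
  assumes "dedekind_domain K R"
    and "\<And>i. i \<in> {1..k} \<Longrightarrow> a i \<in> R - {\<zero>} \<and> b i \<in> R - {\<zero>} \<and> c i \<in> R - {\<zero>}"
    and "primeideal p (ring_on K R)" and "p \<noteq> {\<zero>}"
    and "\<And>i. i \<in> {1..k} \<Longrightarrow> a i \<notin> p \<and> b i \<notin> p \<and> c i \<notin> p \<and> a i \<oplus> b i \<notin> p"
    and "\<And>v\<^sub>1 v\<^sub>2. \<lbrakk> v\<^sub>1 \<in> (\<Union>i\<in>{1..k}. coeff_ratios K (a i) (b i) (c i));
                   v\<^sub>2 \<in> (\<Union>i\<in>{1..k}. coeff_ratios K (a i) (b i) (c i)); v\<^sub>1 \<noteq> v\<^sub>2 \<rbrakk>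
                 \<Longrightarrow> \<not> cong_mod K R p v\<^sub>1 v\<^sub>2"
    and "\<And>v. v \<in> I \<Longrightarrow> \<not> nth_power_mod K R p n v"
    and "finite (a_rcosets\<^bsub>ring_on K R\<^esub> p)"
  shows "\<not> partition_regular (carrier L - {\<zero>\<^bsub>L\<^esub>}) (system_vars k)
           (\<lambda>\<phi>. \<forall>i\<in>{1..k}.
              \<iota> (a i) \<otimes>\<^bsub>L\<^esub> \<phi> (VarX i) \<oplus>\<^bsub>L\<^esub> \<iota> (b i) \<otimes>\<^bsub>L\<^esub> \<phi> (VarY i)
                = \<iota> (c i) \<otimes>\<^bsub>L\<^esub> \<phi> (VarW i) \<otimes>\<^bsub>L\<^esub> (\<phi> (VarZ i) [^]\<^bsub>L\<^esub> n))"
proof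
  interpret D: dedekind_prime K R p
    using assms(4,6,7) by (intro dedekind_prime.intro dedekind_prime_axioms.intro)
  assume pr: "partition_regular (carrier L - {\<zero>\<^bsub>L\<^esub>}) (system_vars k)
           (\<lambda>\<phi>. \<forall>i\<in>{1..k}.
              \<iota> (a i) \<otimes>\<^bsub>L\<^esub> \<phi> (VarX i) \<oplus>\<^bsub>L\<^esub> \<iota> (b i) \<otimes>\<^bsub>L\<^esub> \<phi> (VarY i)
                = \<iota> (c i) \<otimes>\<^bsub>L\<^esub> \<phi> (VarW i) \<otimes>\<^bsub>L\<^esub> (\<phi> (VarZ i) [^]\<^bsub>L\<^esub> n))"
  define S where "S = carrier L - {\<zero>\<^bsub>L\<^esub>}"
  define cell where "cell r = {\<xi> \<in> S. D.colour \<xi> = r}" for r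
  have col: "\<exists>s m. D.represents s \<xi> m (D.colour \<xi>)" if "\<xi> \<in> S" for \<xi>
    using D.colour_represented[of \<xi>] that by (simp add: S_def L_def)
  have "D.colour ` S \<subseteq> carrier (residue_field K R p)"
    using col by (auto simp: D.represents_def)
  moreover have "finite (carrier (residue_field K R p))"
    using assms(11) by (simp add: residue_field_def FactRing_def)
  ultimately have "finite (cell ` D.colour ` S)" by (meson finite_imageI finite_subset)
  moreover have "partition_on S (cell ` D.colour ` S)"
    by (rule partition_onI) (auto simp: cell_def disjnt_def)
  ultimately obtain A \<phi> where A: "A \<in> cell ` D.colour ` S" "\<And>v. v \<in> system_vars k \<Longrightarrow> \<phi> v \<in> A"
    and sol: "\<And>i. i \<in> {1..k} \<Longrightarrow> \<iota> (a i) \<otimes>\<^bsub>L\<^esub> \<phi> (VarX i) \<oplus>\<^bsub>L\<^esub> \<iota> (b i) \<otimes>\<^bsub>L\<^esub> \<phi> (VarY i)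
                = \<iota> (c i) \<otimes>\<^bsub>L\<^esub> \<phi> (VarW i) \<otimes>\<^bsub>L\<^esub> (\<phi> (VarZ i) [^]\<^bsub>L\<^esub> n)"
    using pr unfolding partition_regular_def S_def[symmetric] by meson
  obtain r where r: "A = cell r" "r \<in> carrier (residue_field K R p)"
    using A(1) \<open>D.colour ` S \<subseteq> carrier (residue_field K R p)\<close> by auto
  have rep: "\<exists>s m. D.represents s (\<phi> v) m r" if "v \<in> system_vars k" for v
    using col[of "\<phi> v"] A(2)[OF that] by (auto simp: r cell_def)
  have ratio: "\<exists>v\<in>coeff_ratios K (a i) (b i) (c i). residue_mod K R p v = r [^]\<^bsub>residue_field K R p\<^esub> n"
    if i: "i \<in> {1..k}" for i
  proof -
    have v: "VarX i \<in> system_vars k" "VarY i \<in> system_vars k" "VarW i \<in> system_vars k"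
      "VarZ i \<in> system_vars k"
      using i by (auto simp: system_vars_def)
    obtain x mx y my w mw z mz where reps: "D.represents x (\<phi> (VarX i)) mx r"
      "D.represents y (\<phi> (VarY i)) my r"
      "D.represents w (\<phi> (VarW i)) mw r" "D.represents z (\<phi> (VarZ i)) mz r"
      using rep[OF v(1)] rep[OF v(2)] rep[OF v(3)] rep[OF v(4)] by blast
    have abc: "a i \<in> R - p" "b i \<in> R - p" "c i \<in> R - p" "a i \<oplus> b i \<in> R - p"
      using assms(5)[OF i] assms(8)[OF i] D.R_closed(4) by auto
    show ?thesis using D.monochromatic_residue[OF abc reps sol[OF i, unfolded L_def \<iota>_def]] .
  qed
  show False
  proof (cases "k = 0")
    case True
    \<comment> \<open>An intersection over no equations is the whole type, in which one is an \<open>n\<close>th power.\<close>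
    then have "\<one> \<in> I" by (simp add: I_def)
    then show False using assms(10) D.nth_power_mod_one by blast
  next
    case False
    then have "1 \<in> {1..k}" by simp
    then obtain v where v: "v \<in> coeff_ratios K (a 1) (b 1) (c 1)"
      "residue_mod K R p v = r [^]\<^bsub>residue_field K R p\<^esub> n" using ratio by blast
    have "v \<in> coeff_ratios K (a i) (b i) (c i)" if i: "i \<in> {1..k}" for i
    proof -
      obtain v' where v': "v' \<in> coeff_ratios K (a i) (b i) (c i)"
        "residue_mod K R p v' = r [^]\<^bsub>residue_field K R p\<^esub> n" using ratio[OF i] by blast
      have "cong_mod K R p v v'" using v v' by (simp add: cong_mod_def)
      then have "v = v'" using assms(9)[of v v'] v(1) v'(1) i \<open>1 \<in> {1..k}\<close> by blast
      then show ?thesis using v' by simp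
    qed
    then have "v \<in> I" by (simp add: I_def)
    moreover have "nth_power_mod K R p n v" using v(2) r(2) unfolding nth_power_mod_def by blast
    ultimately show False using assms(10) by blast
  qed
qed

end
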